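(* Let $X=\ell_p$ with $1\le p<\infty$ or $X=c_0$ (sequences indexed by $\mathbb{Z}_+$). Let $(\Omega,\mathcal{F},\mu,\tau)$ be a measure-preserving dynamical system and let $(A_1,A_2)$ be a measurable partition of $\Omega$ with $\mu(A_1)>0$ and $\mu(A_2)>0$. For two bounded sequences $w=(w_n)_{n\ge1}$ and $v=(v_n)_{n\ge1}$ of nonzero scalars, set $T(\omega)=B_w$ if $\omega\in A_1$, $T(\omega)=B_v$ if $\omega\in A_2$, and $T_n(\omega)=T(\tau^{n-1}\omega)\cdots T(\tau\omega)T(\omega)$ for $n\ge1$. (a) Suppose that $B_wB_v=B_vB_w$ and $|w_1|>|v_1|$. Then: - if $B_v$ is hypercyclic, then $(T_n(\omega))_{n\ge1}$ is universal for every $\omega\in\Omega$; and if $(T_n(\omega))_{n\ge1}$ is universal for some $\omega\in\Omega$, then $B_w$ is hypercyclic; - if $B_v$ is mixing, then $(T_n(\omega))_{n\ge1}$ is mixing for every $\omega\in\Omega$; and if $(T_n(\omega))_{n\ge1}$ is mixing for some $\omega\in\Omega$, then $B_w$ is mixing. (b) Moreover, the converse is false: if $(\Omega,\mathcal{F},\mu,\tau)$ is ergodic, one can find bounded sequences $w,v$ of nonzero scalars such that $B_w$ and $B_v$ commute, $|w_1|>|v_1|$, $B_w$ is mixing, $B_v$ is not hypercyclic, and for almost every $\omega\in\Omega$ the sequence $(T_n(\omega))_{n\ge1}$ is not universal.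
   Context: A measure-preserving dynamical system $(\Omega,\mathcal{F},\mu,\tau)$ is a probability space with a measurable map $\tau:\Omega\to\Omega$ such that $\mu(\tau^{-1}(B))=\mu(B)$ for all $B\in\mathcal{F}$; it is ergodic if $\tau^{-1}(A)=A$, $A\in\mathcal F$, implies $\mu(A)\in\{0,1\}$. With $(e_n)_{n\ge0}$ the canonical basis of $X$, the weighted shift $B_w$ is the operator with $B_we_0=0$, $B_we_n=w_ne_{n-1}$ for $n\ge1$; it is continuous on $\ell_p$ or $c_0$ if and only if $w$ is bounded. A sequence $(S_n)_{n\ge1}$ of continuous maps on a metric space $X$ is universal if there is $x\in X$ such that $\{S_nx:n\ge1\}$ is dense in $X$; it is mixing if for all nonempty open $U,V\subset X$ there is $N\ge1$ such that $S_n(U)\cap V\neq\emptyset$ for every $n\ge N$. A single operator $S$ is hypercyclic (respectively mixing) if $(S^n)_{n\ge1}$ is universal (respectively mixing). *)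

theory Defs
  imports "HOL-Analysis.Analysis" "HOL-Probability.Probability"
begin

section \<open>The sequence spaces\<close>

text \<open>
  The scalars form a type of sort \<open>{real_normed_field, euclidean_space}\<close> in the theorem; both
  \<^typ>\<open>real\<close> and \<^typ>\<open>complex\<close> are of this sort (and, by Frobenius, no other field is, up to
  isometric isomorphism).
\<close>

definition lp_norm :: "real \<Rightarrow> (nat \<Rightarrow> 'k::real_normed_vector) \<Rightarrow> real" where
  "lp_norm p x = (\<Sum>n. norm (x n) powr p) powr (1 / p)"

definition lp_space :: "real \<Rightarrow> (nat \<Rightarrow> 'k::real_normed_vector) metric" where
  "lp_space p = metric ({x. summable (\<lambda>n. norm (x n) powr p)}, \<lambda>x y. lp_norm p (\<lambda>n. x n - y n))"

text \<open>
  The library's metrics are nonnegative functions on the whole type, whereas the supremum of an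
  unbounded set is unspecified; hence the case distinction, which is vacuous on the carrier.
\<close>

definition c0_dist :: "(nat \<Rightarrow> 'k::real_normed_vector) \<Rightarrow> (nat \<Rightarrow> 'k) \<Rightarrow> real" where
  "c0_dist x y = (if x \<longlonglongrightarrow> 0 \<and> y \<longlonglongrightarrow> 0 then SUP n. norm (x n - y n) else 0)"

definition c0_space :: "(nat \<Rightarrow> 'k::real_normed_vector) metric" where
  "c0_space = metric ({x. x \<longlonglongrightarrow> 0}, c0_dist)"

lemma powr_convex_bound:
  fixes s t u :: real
  assumes "p \<ge> 1" "0 \<le> s" "0 \<le> t" "0 \<le> u" "u \<le> 1"
  shows "((1 - u) * s + u * t) powr p \<le> (1 - u) * s powr p + u * t powr p"
proof -
  have scale: "(c * r) powr p \<le> c * r powr p" if "0 \<le> c" "c \<le> 1" "0 \<le> r" for c r :: real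
  proof -
    have "c powr p \<le> c"
      using that assms(1) powr_mono'[of 1 p c] by (cases "c = 0") auto
    then show ?thesis
      using that by (simp add: powr_mult mult_right_mono)
  qed
  consider "s = 0" | "t = 0" | "s > 0" "t > 0"
    using assms by linarith
  then show ?thesis
  proof cases
    case 1
    then show ?thesis using scale[of u t] assms by simp
  next
    case 2
    then show ?thesis using scale[of "1 - u" s] assms by simp
  next
    case 3
    then show ?thesis
      using convex_onD[OF powr_convex[OF assms(1)], of u s t] assms by simp
  qed
qed

lemma lp_norm_nonneg: "0 \<le> lp_norm p x"
  by (simp add: lp_norm_def)

lemma lp_norm_powr:
  assumes "p \<ge> 1" "summable (\<lambda>n. norm (x n) powr p)"
  shows "lp_norm p x powr p = (\<Sum>n. norm (x n) powr p)"
  using assms by (simp add: lp_norm_def powr_powr suminf_nonneg)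

lemma lp_norm_eq_0_iff:
  assumes "p \<ge> 1" "summable (\<lambda>n. norm (x n) powr p)"
  shows "lp_norm p x = 0 \<longleftrightarrow> (\<forall>n. x n = 0)"
  using suminf_eq_zero_iff[OF assms(2)] by (simp add: lp_norm_def)

lemma lp_minkowski:
  fixes x y :: "nat \<Rightarrow> 'k::real_normed_vector"
  assumes p: "p \<ge> 1" and x: "summable (\<lambda>n. norm (x n) powr p)"
    and y: "summable (\<lambda>n. norm (y n) powr p)"
  shows "summable (\<lambda>n. norm (x n + y n) powr p)"
    and "lp_norm p (\<lambda>n. x n + y n) \<le> lp_norm p x + lp_norm p y"
proof -
  have gen: "summable (\<lambda>n. norm (x n + y n) powr p) \<and>
      lp_norm p (\<lambda>n. x n + y n) \<le> a + b"
    if a: "a > 0" "lp_norm p x \<le> a" and b: "b > 0" "lp_norm p y \<le> b" for a b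
  proof -
    define c where "c = a + b"
    define u where "u = b / c"
    have c: "c > 0" using a b by (simp add: c_def)
    have u: "0 \<le> u" "u \<le> 1" and ua: "1 - u = a / c"
      using a b c by (auto simp: u_def c_def field_simps)
    define g where "g n = c powr p * ((1 - u) * (norm (x n) powr p / a powr p)
        + u * (norm (y n) powr p / b powr p))" for n
    have le: "norm (x n + y n) powr p \<le> g n" for n
    proof -
      have "norm (x n + y n) \<le> c * ((1 - u) * (norm (x n) / a) + u * (norm (y n) / b))"
      proof -
        have "c * ((1 - u) * (norm (x n) / a) + u * (norm (y n) / b)) = norm (x n) + norm (y n)"
          unfolding ua unfolding u_def using a b c by (simp add: field_simps)
        then show ?thesis
          using norm_triangle_ineq[of "x n" "y n"] by simp
      qed
      then have "norm (x n + y n) powr p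
          \<le> (c * ((1 - u) * (norm (x n) / a) + u * (norm (y n) / b))) powr p"
        using p by (intro powr_mono2) auto
      also have "\<dots> = c powr p * ((1 - u) * (norm (x n) / a) + u * (norm (y n) / b)) powr p"
        using c u a b by (intro powr_mult)
      also have "\<dots> \<le> c powr p * ((1 - u) * (norm (x n) / a) powr p + u * (norm (y n) / b) powr p)"
        using a b u p by (intro mult_left_mono powr_convex_bound) auto
      also have "\<dots> = g n"
        using a b by (simp add: g_def powr_divide)
      finally show ?thesis .
    qed
    have "g sums (c powr p * ((1 - u) * ((\<Sum>n. norm (x n) powr p) / a powr p)
        + u * ((\<Sum>n. norm (y n) powr p) / b powr p)))"
      unfolding g_def using x y
      by (intro sums_mult sums_add sums_divide summable_sums)
    then have g: "summable g" and sg: "suminf g = c powr p * ((1 - u) * (lp_norm p x powr p / a powr p)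
        + u * (lp_norm p y powr p / b powr p))"
      using p x y by (auto simp: sums_iff lp_norm_powr)
    have s: "summable (\<lambda>n. norm (x n + y n) powr p)"
      using le by (intro summable_comparison_test'[OF g]) auto
    have "lp_norm p x powr p / a powr p \<le> 1" "lp_norm p y powr p / b powr p \<le> 1"
      using a b p by (auto simp: divide_le_eq intro!: powr_mono2 lp_norm_nonneg)
    then have "(1 - u) * (lp_norm p x powr p / a powr p) + u * (lp_norm p y powr p / b powr p)
        \<le> (1 - u) * 1 + u * 1"
      using u by (intro add_mono mult_left_mono) auto
    then have "suminf g \<le> c powr p * 1"
      unfolding sg by (intro mult_left_mono) auto
    moreover have "(\<Sum>n. norm (x n + y n) powr p) \<le> suminf g"
      using le s g by (intro suminf_le)
    ultimately have "lp_norm p (\<lambda>n. x n + y n) \<le> (c powr p) powr (1 / p)"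
      unfolding lp_norm_def using p s by (intro powr_mono2) (auto intro!: suminf_nonneg)
    then show ?thesis
      using s c p by (simp add: powr_powr c_def)
  qed
  have pos: "lp_norm p x + 1 > 0" "lp_norm p y + 1 > 0"
    using lp_norm_nonneg[of p x] lp_norm_nonneg[of p y] by linarith+
  show "summable (\<lambda>n. norm (x n + y n) powr p)"
    using gen[of "lp_norm p x + 1" "lp_norm p y + 1"] pos by simp
  show "lp_norm p (\<lambda>n. x n + y n) \<le> lp_norm p x + lp_norm p y"
  proof (rule field_le_epsilon)
    fix e :: real assume "e > 0"
    moreover have "0 \<le> lp_norm p x" "0 \<le> lp_norm p y" by (rule lp_norm_nonneg)+
    ultimately show "lp_norm p (\<lambda>n. x n + y n) \<le> lp_norm p x + lp_norm p y + e"
      using gen[of "lp_norm p x + e / 2" "lp_norm p y + e / 2"] by simp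
  qed
qed

lemma lp_summable_diff:
  assumes "p \<ge> 1" "summable (\<lambda>n. norm (x n) powr p)" "summable (\<lambda>n. norm (y n) powr p)"
  shows "summable (\<lambda>n. norm (x n - y n) powr p)"
  using lp_minkowski(1)[OF assms(1,2), of "\<lambda>n. - y n"] assms(3) by simp

lemma Metric_space_lp:
  assumes p: "p \<ge> 1"
  shows "Metric_space {x :: nat \<Rightarrow> 'k::real_normed_vector. summable (\<lambda>n. norm (x n) powr p)}
    (\<lambda>x y. lp_norm p (\<lambda>n. x n - y n))"
proof
  fix x y z :: "nat \<Rightarrow> 'k"
  show "0 \<le> lp_norm p (\<lambda>n. x n - y n)"
    by (rule lp_norm_nonneg)
  show "lp_norm p (\<lambda>n. x n - y n) = lp_norm p (\<lambda>n. y n - x n)"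
    by (simp add: lp_norm_def norm_minus_commute)
  assume x: "x \<in> {x. summable (\<lambda>n. norm (x n) powr p)}"
    and y: "y \<in> {x. summable (\<lambda>n. norm (x n) powr p)}"
  then show "lp_norm p (\<lambda>n. x n - y n) = 0 \<longleftrightarrow> x = y"
    using lp_norm_eq_0_iff[OF p lp_summable_diff[OF p, of x y]] by auto
  assume z: "z \<in> {x. summable (\<lambda>n. norm (x n) powr p)}"
  show "lp_norm p (\<lambda>n. x n - z n) \<le> lp_norm p (\<lambda>n. x n - y n) + lp_norm p (\<lambda>n. y n - z n)"
    using lp_minkowski(2)[OF p lp_summable_diff[OF p, of x y] lp_summable_diff[OF p, of y z]] x y z
    by simp
qed

lemma c0_bdd_above:
  fixes x y :: "nat \<Rightarrow> 'k::real_normed_vector"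
  assumes "x \<longlonglongrightarrow> 0" "y \<longlonglongrightarrow> 0"
  shows "bdd_above (range (\<lambda>n. norm (x n - y n)))"
proof -
  have "Bseq (\<lambda>n. x n - y n)"
    using tendsto_diff[OF assms] by (intro convergent_imp_Bseq) (auto simp: convergent_def)
  then show ?thesis
    by (auto simp: Bseq_def bdd_above_def)
qed

lemma Metric_space_c0:
  "Metric_space {x :: nat \<Rightarrow> 'k::real_normed_vector. x \<longlonglongrightarrow> 0} c0_dist"
proof
  fix x y z :: "nat \<Rightarrow> 'k"
  have upper: "norm (x n - y n) \<le> c0_dist x y" if "x \<longlonglongrightarrow> 0" "y \<longlonglongrightarrow> 0" for n and x y :: "nat \<Rightarrow> 'k"
    using cSUP_upper[OF UNIV_I c0_bdd_above[OF that], of n] that by (simp add: c0_dist_def)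
  show nn: "0 \<le> c0_dist x y"
  proof (cases "x \<longlonglongrightarrow> 0 \<and> y \<longlonglongrightarrow> 0")
    case True
    then show ?thesis using order_trans[OF norm_ge_zero upper[of x y 0]] by blast
  qed (auto simp: c0_dist_def)
  show "c0_dist x y = c0_dist y x"
    by (auto simp: c0_dist_def norm_minus_commute)
  assume xy: "x \<in> {x. x \<longlonglongrightarrow> 0}" "y \<in> {x. x \<longlonglongrightarrow> 0}"
  show "c0_dist x y = 0 \<longleftrightarrow> x = y"
  proof
    assume "c0_dist x y = 0"
    then show "x = y" using upper[of x y] xy by auto
  next
    assume "x = y"
    then show "c0_dist x y = 0" by (simp add: c0_dist_def)
  qed
  assume z: "z \<in> {x. x \<longlonglongrightarrow> 0}"
  have "norm (x n - z n) \<le> c0_dist x y + c0_dist y z" for n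
    using norm_triangle_ineq[of "x n - y n" "y n - z n"] upper[of x y n] upper[of y z n] xy z by simp
  then have "(SUP n. norm (x n - z n)) \<le> c0_dist x y + c0_dist y z"
    by (intro cSUP_least) auto
  then show "c0_dist x z \<le> c0_dist x y + c0_dist y z"
    using xy z by (simp add: c0_dist_def)
qed

lemma mspace_lp_space: "p \<ge> 1 \<Longrightarrow> mspace (lp_space p) = {x. summable (\<lambda>n. norm (x n) powr p)}"
  unfolding lp_space_def by (rule Metric_space.mspace_metric[OF Metric_space_lp])

lemma mdist_lp_space: "p \<ge> 1 \<Longrightarrow> mdist (lp_space p) = (\<lambda>x y. lp_norm p (\<lambda>n. x n - y n))"
  unfolding lp_space_def by (rule Metric_space.mdist_metric[OF Metric_space_lp])

lemma mspace_c0_space: "mspace c0_space = {x. x \<longlonglongrightarrow> 0}"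
  unfolding c0_space_def by (rule Metric_space.mspace_metric[OF Metric_space_c0])

lemma mdist_c0_space:
  "x \<longlonglongrightarrow> 0 \<Longrightarrow> y \<longlonglongrightarrow> 0 \<Longrightarrow> mdist c0_space x y = (SUP n. norm (x n - y n))"
  unfolding c0_space_def by (simp add: Metric_space.mdist_metric[OF Metric_space_c0] c0_dist_def)


section \<open>Linear dynamics\<close>

text \<open>Only the maps \<open>S n\<close> with \<open>n \<ge> 1\<close> are taken into account.\<close>

definition universal :: "'a metric \<Rightarrow> (nat \<Rightarrow> 'a \<Rightarrow> 'a) \<Rightarrow> bool" where
  "universal X S \<longleftrightarrow> (\<exists>x\<in>mspace X. mtopology_of X closure_of {S n x | n. n \<ge> 1} = mspace X)"

definition mixing_seq :: "'a metric \<Rightarrow> (nat \<Rightarrow> 'a \<Rightarrow> 'a) \<Rightarrow> bool" where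
  "mixing_seq X S \<longleftrightarrow>
     (\<forall>U V. openin (mtopology_of X) U \<and> openin (mtopology_of X) V \<and> U \<noteq> {} \<and> V \<noteq> {} \<longrightarrow>
       (\<exists>N\<ge>1. \<forall>n\<ge>N. S n ` U \<inter> V \<noteq> {}))"

definition hypercyclic :: "'a metric \<Rightarrow> ('a \<Rightarrow> 'a) \<Rightarrow> bool" where
  "hypercyclic X S \<longleftrightarrow> universal X (\<lambda>n. S ^^ n)"

definition mixing :: "'a metric \<Rightarrow> ('a \<Rightarrow> 'a) \<Rightarrow> bool" where
  "mixing X S \<longleftrightarrow> mixing_seq X (\<lambda>n. S ^^ n)"

text \<open>Weights are indexed by \<open>n \<ge> 1\<close>; the value at \<open>0\<close> is never used.\<close>

definition admissible_weights :: "(nat \<Rightarrow> 'k::real_normed_field) \<Rightarrow> bool" where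
  "admissible_weights w \<longleftrightarrow> bounded (w ` {1..}) \<and> (\<forall>n\<ge>1. w n \<noteq> 0)"

text \<open>
  The coordinatewise form of the operator sending \<open>e\<^sub>0\<close> to \<open>0\<close> and \<open>e\<^sub>n\<close> to \<open>w\<^sub>n e\<^sub>n\<^sub>-\<^sub>1\<close> for \<open>n \<ge> 1\<close>.
\<close>

definition weighted_shift :: "(nat \<Rightarrow> 'k::real_normed_field) \<Rightarrow> (nat \<Rightarrow> 'k) \<Rightarrow> nat \<Rightarrow> 'k" where
  "weighted_shift w x = (\<lambda>n. w (Suc n) * x (Suc n))"

definition basis_seq :: "nat \<Rightarrow> nat \<Rightarrow> 'k::real_normed_field" where
  "basis_seq n = (\<lambda>i. if i = n then 1 else 0)"

lemma weighted_shift_basis_0: "weighted_shift w (basis_seq 0) = (\<lambda>i. 0)"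
  by (simp add: weighted_shift_def basis_seq_def)

lemma weighted_shift_basis:
  "n \<ge> 1 \<Longrightarrow> weighted_shift w (basis_seq n) = (\<lambda>i. w n * basis_seq (n - 1) i)"
  by (auto simp: weighted_shift_def basis_seq_def fun_eq_iff)

lemma weighted_shift_linear:
  "weighted_shift w (\<lambda>i. a * x i + b * y i) = (\<lambda>i. a * weighted_shift w x i + b * weighted_shift w y i)"
  by (simp add: weighted_shift_def algebra_simps)

lemma weighted_shift_Lipschitz:
  fixes X :: "(nat \<Rightarrow> 'k::real_normed_field) metric"
  assumes X: "X = c0_space \<or> (\<exists>p\<ge>1. X = lp_space p)" and w: "bounded (w ` {1..})"
  shows "Lipschitz_continuous_map X X (weighted_shift w)"
proof -
  obtain C where C: "C > 0" "\<And>n. norm (w (Suc n)) \<le> C"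
    using w unfolding bounded_pos by fastforce
  have bound: "norm (weighted_shift w x n - weighted_shift w y n) \<le> C * norm (x (Suc n) - y (Suc n))"
    for x y n
    using C by (simp add: weighted_shift_def right_diff_distrib[symmetric] norm_mult mult_right_mono)
  have bound0: "norm (weighted_shift w x n) \<le> C * norm (x (Suc n))" for x n
    using C by (simp add: weighted_shift_def norm_mult mult_right_mono)
  from X show ?thesis
  proof
    assume X: "X = c0_space"
    have maps: "weighted_shift w x \<longlonglongrightarrow> 0" if "x \<longlonglongrightarrow> 0" for x
    proof (rule Lim_null_comparison)
      show "(\<lambda>n. C * norm (x (Suc n))) \<longlonglongrightarrow> 0"
        using that by (intro tendsto_mult_right_zero tendsto_norm_zero LIMSEQ_Suc)
    qed (use bound0 in auto)
    have "mdist X (weighted_shift w x) (weighted_shift w y) \<le> C * mdist X x y"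
      if xy: "x \<in> mspace X" "y \<in> mspace X" for x y
    proof -
      have x: "x \<longlonglongrightarrow> 0" and y: "y \<longlonglongrightarrow> 0" using xy by (auto simp: X mspace_c0_space)
      have "norm (weighted_shift w x n - weighted_shift w y n) \<le> C * (SUP n. norm (x n - y n))" for n
        using bound[of x n y] C cSUP_upper[OF UNIV_I c0_bdd_above[OF x y], of "Suc n"]
        by (meson mult_left_mono order_trans less_imp_le)
      then show ?thesis
        by (simp add: X mdist_c0_space x y maps cSUP_least)
    qed
    with maps show ?thesis
      by (auto simp: Lipschitz_continuous_map_def X mspace_c0_space)
  next
    assume "\<exists>p\<ge>1. X = lp_space p"
    then obtain p where p: "p \<ge> 1" and X: "X = lp_space p" by blast
    have pw: "norm a powr p \<le> C powr p * norm b powr p" if "norm a \<le> C * norm b" for a b :: 'k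
      using powr_mono2[of p "norm a" "C * norm b"] that C p by (simp add: powr_mult)
    have maps: "summable (\<lambda>n. norm (weighted_shift w x n) powr p)"
      if x: "summable (\<lambda>n. norm (x n) powr p)" for x
    proof (rule summable_comparison_test')
      show "summable (\<lambda>n. C powr p * norm (x (Suc n)) powr p)"
        using x by (intro summable_mult) (simp add: summable_Suc_iff[of "\<lambda>n. norm (x n) powr p"])
      show "norm (norm (weighted_shift w x n) powr p) \<le> C powr p * norm (x (Suc n)) powr p" for n
        using pw[OF bound0[of x n]] by simp
    qed
    have "mdist X (weighted_shift w x) (weighted_shift w y) \<le> C * mdist X x y"
      if xy: "x \<in> mspace X" "y \<in> mspace X" for x y
    proof -
      have x: "summable (\<lambda>n. norm (x n) powr p)" and y: "summable (\<lambda>n. norm (y n) powr p)"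
        using xy p by (auto simp: X mspace_lp_space)
      note xy' = lp_summable_diff[OF p x y]
      have s1: "summable (\<lambda>n. norm (x (Suc n) - y (Suc n)) powr p)"
        using xy' by (simp add: summable_Suc_iff[of "\<lambda>n. norm (x n - y n) powr p"])
      have "(\<Sum>n. norm (weighted_shift w x n - weighted_shift w y n) powr p)
          \<le> (\<Sum>n. C powr p * norm (x (Suc n) - y (Suc n)) powr p)"
        using lp_summable_diff[OF p maps[OF x] maps[OF y]] s1 pw[OF bound]
        by (intro suminf_le summable_mult) auto
      also have "\<dots> = C powr p * (\<Sum>n. norm (x (Suc n) - y (Suc n)) powr p)"
        using s1 by (rule suminf_mult)
      also have "\<dots> \<le> C powr p * (\<Sum>n. norm (x n - y n) powr p)"
        using suminf_split_head[OF xy'] by (intro mult_left_mono) auto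
      finally have "(\<Sum>n. norm (weighted_shift w x n - weighted_shift w y n) powr p)
          \<le> C powr p * (\<Sum>n. norm (x n - y n) powr p)" .
      then have "lp_norm p (\<lambda>n. weighted_shift w x n - weighted_shift w y n)
          \<le> (C powr p * (\<Sum>n. norm (x n - y n) powr p)) powr (1 / p)"
        unfolding lp_norm_def using p lp_summable_diff[OF p maps[OF x] maps[OF y]]
        by (intro powr_mono2) (auto intro!: suminf_nonneg)
      also have "\<dots> = C * lp_norm p (\<lambda>n. x n - y n)"
        using C p xy' by (simp add: lp_norm_def powr_mult powr_powr suminf_nonneg)
      finally show ?thesis
        by (simp add: X mdist_lp_space p)
    qed
    with maps show ?thesis
      by (auto simp: Lipschitz_continuous_map_def X mspace_lp_space p)
  qed
qed


section \<open>Dynamical systems and random products\<close>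

definition measure_preserving_system :: "'o measure \<Rightarrow> ('o \<Rightarrow> 'o) \<Rightarrow> bool" where
  "measure_preserving_system M \<tau> \<longleftrightarrow>
     prob_space M \<and> \<tau> \<in> measurable M M \<and>
     (\<forall>B\<in>sets M. measure M (\<tau> -` B \<inter> space M) = measure M B)"

definition ergodic_system :: "'o measure \<Rightarrow> ('o \<Rightarrow> 'o) \<Rightarrow> bool" where
  "ergodic_system M \<tau> \<longleftrightarrow>
     measure_preserving_system M \<tau> \<and>
     (\<forall>A\<in>sets M. \<tau> -` A \<inter> space M = A \<longrightarrow> measure M A \<in> {0, 1})"

text \<open>\<open>random_product T \<tau> n \<omega>\<close> is \<open>T(\<tau>\<^sup>n\<^sup>-\<^sup>1 \<omega>) \<circ> \<dots> \<circ> T(\<tau> \<omega>) \<circ> T(\<omega>)\<close>.\<close>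

primrec random_product :: "('o \<Rightarrow> 'a \<Rightarrow> 'a) \<Rightarrow> ('o \<Rightarrow> 'o) \<Rightarrow> nat \<Rightarrow> 'o \<Rightarrow> 'a \<Rightarrow> 'a" where
  "random_product T \<tau> 0 \<omega> = id"
| "random_product T \<tau> (Suc n) \<omega> = T ((\<tau> ^^ n) \<omega>) \<circ> random_product T \<tau> n \<omega>"

text \<open>On \<open>\<Omega>\<close> the complement of \<open>A\<^sub>1\<close> is \<open>A\<^sub>2\<close>.\<close>

definition random_shift ::
    "'o set \<Rightarrow> (nat \<Rightarrow> 'k::real_normed_field) \<Rightarrow> (nat \<Rightarrow> 'k) \<Rightarrow> 'o \<Rightarrow> (nat \<Rightarrow> 'k) \<Rightarrow> (nat \<Rightarrow> 'k)" where
  "random_shift A1 w v \<omega> = (if \<omega> \<in> A1 then weighted_shift w else weighted_shift v)"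

definition random_shift_seq ::
    "('o \<Rightarrow> 'o) \<Rightarrow> 'o set \<Rightarrow> (nat \<Rightarrow> 'k::real_normed_field) \<Rightarrow> (nat \<Rightarrow> 'k) \<Rightarrow> 'o \<Rightarrow> nat
      \<Rightarrow> (nat \<Rightarrow> 'k) \<Rightarrow> (nat \<Rightarrow> 'k)" where
  "random_shift_seq \<tau> A1 w v \<omega> n = random_product (random_shift A1 w v) \<tau> n \<omega>"

definition commute_on :: "'a metric \<Rightarrow> ('a \<Rightarrow> 'a) \<Rightarrow> ('a \<Rightarrow> 'a) \<Rightarrow> bool" where
  "commute_on X S R \<longleftrightarrow> (\<forall>x\<in>mspace X. S (R x) = R (S x))"

end

theory Submission
  imports Defs
begin

text \<open>
  Comparing \<open>B\<^sub>w B\<^sub>v\<close> with \<open>B\<^sub>v B\<^sub>w\<close> on the basis shows that two weighted shifts commute only if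
  \<open>v = c w\<close> for a scalar \<open>c\<close>; here \<open>0 < \<bar>c\<bar> < 1\<close>. Hence \<open>T\<^sub>n(\<omega>) = c\<^bsup>k(n)\<^esup> B\<^sub>w\<^sup>n\<close>, where \<open>k(n)\<close> is the
  number of visits of the orbit of \<open>\<omega>\<close> to the complement of \<open>A\<^sub>1\<close> before time \<open>n\<close>. Everything is
  thus a question about operators \<open>S\<^sub>n = a\<^sub>n B\<^sub>w\<^sup>n\<close> with nonzero factors \<open>a\<^sub>n\<close> of decreasing modulus.
  With \<open>W\<^sub>n = w\<^sub>1 \<dots> w\<^sub>n\<close>, such a sequence is universal if and only if \<open>a\<^sub>n W\<^sub>n\<close> is unbounded, and
  mixing if and only if \<open>\<bar>a\<^sub>n W\<^sub>n\<bar>\<close> tends to infinity (\<open>universal_scaled_shift_powers_iff\<close>,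
  \<open>mixing_scaled_shift_powers_iff\<close>).
  
  Necessity is read off the coordinate \<open>0\<close> of \<open>S\<^sub>n x\<close>, which is \<open>a\<^sub>n W\<^sub>n x\<^sub>n\<close>. For sufficiency, \<open>S\<^sub>n\<close>
  has an explicit right inverse \<open>R\<^sub>n\<close> on finitely supported vectors, and \<open>R\<^sub>n y\<close> is small when
  \<open>\<bar>a\<^sub>m W\<^sub>m\<bar>\<close> is large for an \<open>m\<close> slightly above \<open>n\<close>: the modulus of \<open>a\<close> decreases and the weights are
  bounded, so largeness at \<open>m\<close> spreads to the indices just before \<open>m\<close>. Mixing follows with the
  vectors \<open>x + R\<^sub>n y\<close>, and a universal vector is a sum of vectors \<open>R\<^sub>n y\<close> with \<open>n\<close> increasing rapidly and \<open>y\<close>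
  running through a countable dense set. All perturbations are small even in the norm of \<open>\<ell>\<^sub>1\<close>,
  which dominates the norms of \<open>c\<^sub>0\<close> and of each \<open>\<ell>\<^sub>p\<close>; this is why one argument serves all the
  spaces.
  
  Since \<open>0 \<le> k(n) \<le> n\<close>, the quantity \<open>\<bar>c\<^bsup>k(n)\<^esup> W\<^sub>n\<bar>\<close> lies between \<open>\<bar>c\<^sup>n W\<^sub>n\<bar>\<close>, which belongs to
  \<open>B\<^sub>v\<close>, and \<open>\<bar>W\<^sub>n\<bar>\<close>, which belongs to \<open>B\<^sub>w\<close>. That is part (a), for every single \<open>\<omega>\<close>
  (\<open>random_shift_between\<close>).
  
  For part (b) take \<open>c = 1/2\<close> and let \<open>W\<^sub>n\<close> grow to infinity so slowly that \<open>W\<^sub>n \<le> C 2\<^bsup>k(n)\<^esup>\<close> for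
  almost every \<open>\<omega>\<close>, with \<open>C\<close> depending on \<open>\<omega>\<close>. The weights may be adapted to the speed at which \<open>k(n)\<close>
  grows in the given system. By ergodicity \<open>k(n)\<close> tends to infinity almost surely,
  and by the Borel--Cantelli lemma there are then times \<open>r(j)\<close>, independent of \<open>\<omega>\<close>, such that almost
  surely \<open>k(r(j)) \<ge> j\<close> for all large \<open>j\<close>. The weights equal \<open>2\<close> at these times and \<open>1\<close> elsewhere
  (\<open>ergodic_counterexample\<close>).
\<close>

section \<open>Estimates in the sequence spaces through the absolutely summable sequences\<close>

lemma coord_le_mdist:
  fixes X :: "(nat \<Rightarrow> 'k::real_normed_field) metric"
  assumes X: "X = c0_space \<or> (\<exists>p\<ge>1. X = lp_space p)"
    and xy: "x \<in> mspace X" "y \<in> mspace X"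
  shows "norm (x n - y n) \<le> mdist X x y"
  using X
proof
  assume X: "X = c0_space"
  have x: "x \<longlonglongrightarrow> 0" and y: "y \<longlonglongrightarrow> 0" using xy by (auto simp: X mspace_c0_space)
  show ?thesis
    using cSUP_upper[OF UNIV_I c0_bdd_above[OF x y], of n] by (simp add: X mdist_c0_space x y)
next
  assume "\<exists>p\<ge>1. X = lp_space p"
  then obtain p where p: "p \<ge> 1" and X: "X = lp_space p" by blast
  have s: "summable (\<lambda>n. norm (x n - y n) powr p)"
    using xy p by (intro lp_summable_diff) (auto simp: X mspace_lp_space)
  have "norm (x n - y n) powr p \<le> (\<Sum>n. norm (x n - y n) powr p)"
    using sum_le_suminf[OF s, of "{n}"] by simp
  then have "(norm (x n - y n) powr p) powr (1 / p) \<le> lp_norm p (\<lambda>n. x n - y n)"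
    unfolding lp_norm_def using p by (intro powr_mono2) auto
  then show ?thesis using p by (simp add: X mdist_lp_space powr_powr)
qed

text \<open>
  If \<open>s\<close> is the sum of the moduli, each coordinate is at most \<open>s\<close>, whence
  \<open>\<bar>z\<^sub>n\<bar>\<^sup>p \<le> s\<^bsup>p-1\<^esup> \<bar>z\<^sub>n\<bar>\<close>; summation gives the bound.
\<close>

lemma lp_norm_le_l1:
  fixes z :: "nat \<Rightarrow> 'k::real_normed_vector"
  assumes p: "p \<ge> 1" and z: "summable (\<lambda>n. norm (z n))"
  shows "summable (\<lambda>n. norm (z n) powr p)" and "lp_norm p z \<le> (\<Sum>n. norm (z n))"
proof -
  define s where "s = (\<Sum>n. norm (z n))"
  have ns: "norm (z n) \<le> s" for n
    using sum_le_suminf[OF z, of "{n}"] by (simp add: s_def)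
  have s0: "s \<ge> 0" using ns[of 0] norm_ge_zero order_trans by blast
  have le: "norm (z n) powr p \<le> s powr (p - 1) * norm (z n)" for n
  proof (cases "z n = 0")
    case False
    have "norm (z n) powr p = norm (z n) powr (p - 1) * norm (z n)"
      using False powr_add[of "norm (z n)" "p - 1" 1] by simp
    also have "\<dots> \<le> s powr (p - 1) * norm (z n)"
      using p ns[of n] by (intro mult_right_mono powr_mono2) auto
    finally show ?thesis .
  qed simp
  show sp: "summable (\<lambda>n. norm (z n) powr p)"
    using le by (intro summable_comparison_test'[OF summable_mult[OF z]]) auto
  have "(\<Sum>n. norm (z n) powr p) \<le> (\<Sum>n. s powr (p - 1) * norm (z n))"
    using le sp summable_mult[OF z] by (intro suminf_le)
  also have "\<dots> = s powr (p - 1) * s" using suminf_mult[OF z] by (simp add: s_def)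
  also have "\<dots> = s powr p"
    using s0 powr_add[of s "p - 1" 1] by (cases "s = 0") auto
  finally have "lp_norm p z \<le> (s powr p) powr (1 / p)"
    unfolding lp_norm_def using p sp by (intro powr_mono2) (auto intro!: suminf_nonneg)
  then show "lp_norm p z \<le> (\<Sum>n. norm (z n))"
    using p s0 by (simp add: powr_powr s_def)
qed

text \<open>
  The norm of \<open>\<ell>\<^sub>1\<close> dominates that of \<open>c\<^sub>0\<close> and of each \<open>\<ell>\<^sub>p\<close>, so that a perturbation that is small in \<open>\<ell>\<^sub>1\<close>
  is small in each of these spaces. The hypothesis is in terms of partial sums and the conclusion
  includes membership, because the vectors \<open>x\<close> constructed below are given by their coordinates only.
\<close>

lemma l1_perturbation:
  fixes X :: "(nat \<Rightarrow> 'k::real_normed_field) metric"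
  assumes X: "X = c0_space \<or> (\<exists>p\<ge>1. X = lp_space p)"
    and y: "y \<in> mspace X" and e: "\<And>M. (\<Sum>m<M. norm (x m - y m)) \<le> e"
  shows "x \<in> mspace X" and "mdist X x y \<le> e"
proof -
  have s: "summable (\<lambda>m. norm (x m - y m))"
    using e by (intro summableI_nonneg_bounded) auto
  have se: "(\<Sum>m. norm (x m - y m)) \<le> e"
    using e s by (intro suminf_le_const) auto
  have "x \<in> mspace X \<and> mdist X x y \<le> e"
    using X
  proof
    assume X: "X = c0_space"
    have y0: "y \<longlonglongrightarrow> 0" using y by (auto simp: X mspace_c0_space)
    have "(\<lambda>m. (x m - y m) + y m) \<longlonglongrightarrow> 0 + 0"
      using s y0 by (intro tendsto_add) (auto dest!: summable_LIMSEQ_zero simp: tendsto_norm_zero_iff)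
    then have x0: "x \<longlonglongrightarrow> 0" by simp
    have "norm (x n - y n) \<le> e" for n
      using sum_le_suminf[OF s, of "{n}"] se by simp
    then show ?thesis
      using x0 y0 by (auto simp: X mspace_c0_space mdist_c0_space intro: cSUP_least)
  next
    assume "\<exists>p\<ge>1. X = lp_space p"
    then obtain p where p: "p \<ge> 1" and X: "X = lp_space p" by blast
    show ?thesis
      using lp_minkowski(1)[OF p lp_norm_le_l1(1)[OF p s], of y] y lp_norm_le_l1(2)[OF p s] se p
      by (simp add: X mspace_lp_space mdist_lp_space)
  qed
  then show "x \<in> mspace X" "mdist X x y \<le> e" by auto
qed

lemma zero_in_mspace:
  fixes X :: "(nat \<Rightarrow> 'k::real_normed_field) metric"
  assumes X: "X = c0_space \<or> (\<exists>p\<ge>1. X = lp_space p)"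
  shows "(\<lambda>_. 0) \<in> mspace X"
  using X by (auto simp: mspace_c0_space mspace_lp_space)

lemma finite_support_in_mspace:
  fixes X :: "(nat \<Rightarrow> 'k::real_normed_field) metric"
  assumes X: "X = c0_space \<or> (\<exists>p\<ge>1. X = lp_space p)" and y: "\<forall>i\<ge>L. y i = 0"
  shows "y \<in> mspace X"
proof (rule l1_perturbation(1)[OF X zero_in_mspace[OF X]])
  fix M
  have "(\<Sum>m<M. norm (y m - 0)) \<le> (\<Sum>m<max M L. norm (y m - 0))"
    by (intro sum_mono2) auto
  also have "\<dots> = (\<Sum>m<L. norm (y m))"
    using y by (intro sum.mono_neutral_cong_right) auto
  finally show "(\<Sum>m<M. norm (y m - 0)) \<le> (\<Sum>m<L. norm (y m))" .
qed

lemma finite_support_dense: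
  fixes X :: "(nat \<Rightarrow> 'k::real_normed_field) metric"
  assumes X: "X = c0_space \<or> (\<exists>p\<ge>1. X = lp_space p)"
    and x: "x \<in> mspace X" and e: "e > 0"
  obtains L y where "\<forall>i\<ge>L. y i = 0" "y \<in> mspace X" "mdist X x y < e"
proof -
  have "\<exists>N. mdist X x (\<lambda>i. if i < N then x i else 0) < e"
    using X
  proof
    assume X': "X = c0_space"
    then have x0: "x \<longlonglongrightarrow> 0" using x by (simp add: mspace_c0_space)
    from LIMSEQ_D[OF this, of "e / 2"] e obtain N where N: "\<And>n. n \<ge> N \<Longrightarrow> norm (x n) < e / 2"
      by auto
    let ?y = "\<lambda>i. if i < N then x i else 0"
    have "?y \<in> mspace X" using finite_support_in_mspace[OF X, of N ?y] by simp
    then have "mdist X x ?y = (SUP n. norm (x n - ?y n))"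
      using x0 unfolding X' by (intro mdist_c0_space) (auto simp: mspace_c0_space)
    also have "\<dots> \<le> e / 2"
      using N e less_imp_le by (intro cSUP_least) (auto simp: not_less)
    finally show ?thesis using e by (intro exI[of _ N]) simp
  next
    assume "\<exists>p\<ge>1. X = lp_space p"
    then obtain p where p: "p \<ge> 1" and X': "X = lp_space p" by blast
    have s: "summable (\<lambda>n. norm (x n) powr p)" using x p by (simp add: X' mspace_lp_space)
    have "0 < (e/2) powr p" using e by simp
    from suminf_exist_split[OF this s] obtain N
      where "norm (\<Sum>i. norm (x (i + N)) powr p) < (e/2) powr p"
      by blast
    then have N: "(\<Sum>i. norm (x (i + N)) powr p) < (e/2) powr p" by simp
    let ?y = "\<lambda>i. if i < N then x i else 0"
    have "?y \<in> mspace X" using finite_support_in_mspace[OF X, of N ?y] by simp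
    then have sy: "summable (\<lambda>n. norm (x n - ?y n) powr p)"
      using p s by (intro lp_summable_diff) (auto simp: X' mspace_lp_space)
    have "(\<Sum>n. norm (x n - ?y n) powr p) = (\<Sum>i. norm (x (i + N)) powr p)"
      using suminf_split_initial_segment[OF sy, of N] by simp
    then have "lp_norm p (\<lambda>n. x n - ?y n) \<le> ((e/2) powr p) powr (1/p)"
      unfolding lp_norm_def using N p sy by (intro powr_mono2)
      (auto intro!: suminf_nonneg summable_ignore_initial_segment s)
    also have "\<dots> = e / 2" using p e by (simp add: powr_powr)
    finally show ?thesis using e p by (intro exI[of _ N]) (simp add: X' mdist_lp_space)
  qed
  then obtain N where "mdist X x (\<lambda>i. if i < N then x i else 0) < e" by blast
  then show ?thesis
    using that[of N "\<lambda>i. if i < N then x i else 0"]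
      finite_support_in_mspace[OF X, of N "\<lambda>i. if i < N then x i else 0"] by simp
qed

text \<open>
  The targets are the finite lists of elements of a countable dense set of scalars, padded with
  zeros. For the construction of a universal vector each target has to occur infinitely often;
  enumerating pairs of a list and a natural number and ignoring the latter achieves this.
\<close>

lemma dense_target_sequence:
  fixes X :: "(nat \<Rightarrow> 'k::{real_normed_field, euclidean_space}) metric"
  assumes X: "X = c0_space \<or> (\<exists>p\<ge>1. X = lp_space p)"
  obtains y :: "nat \<Rightarrow> nat \<Rightarrow> 'k" and L :: "nat \<Rightarrow> nat"
  where "\<And>k i. i \<ge> L k \<Longrightarrow> y k i = 0"
    and "\<And>x e K. x \<in> mspace X \<Longrightarrow> e > 0 \<Longrightarrow> \<exists>k\<ge>K. mdist X x (y k) < e"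
proof -
  obtain D :: "'k set" where D: "countable D" "\<And>U. open U \<Longrightarrow> U \<noteq> {} \<Longrightarrow> \<exists>d\<in>D. d \<in> U"
    using countable_dense_setE by blast
  have "D \<noteq> {}" using D(2)[of UNIV] by auto
  then have rD: "range (from_nat_into D) = D" using D(1) by (rule range_from_nat_into)
  have appr: "\<exists>j. norm (a - from_nat_into D j) < e" if e: "e > 0" for a e
  proof -
    obtain d where "d \<in> D" "norm (a - d) < e"
      using D(2)[of "ball a e"] e by (auto simp: dist_norm)
    then show ?thesis using rD by (metis imageE)
  qed
  define l where "l k = fst (from_nat k :: nat list \<times> nat)" for k
  define y where "y k i = (if i < length (l k) then from_nat_into D (l k ! i) else 0)" for k i
  have y0: "i \<ge> length (l k) \<Longrightarrow> y k i = 0" for k i by (simp add: y_def)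
  show thesis
  proof (rule that[of "\<lambda>k. length (l k)" y])
    fix x and e :: real and K :: nat
    assume x: "x \<in> mspace X" and e: "e > 0"
    interpret Metric_space "mspace X" "mdist X" by simp
    obtain N u where u: "\<forall>i\<ge>N. u i = 0" "u \<in> mspace X" "mdist X x u < e / 2"
      using finite_support_dense[OF X x, of "e / 2"] e by auto
    \<comment> \<open>An error of at most \<open>d\<close> in each of the first \<open>N\<close> coordinates adds up to at most \<open>e / 2\<close>.\<close>
    define d where "d = e / (2 * (real N + 1))"
    have d: "d > 0" using e by (simp add: d_def)
    from appr[OF this] obtain f where f: "\<And>a. norm (a - from_nat_into D (f a)) < d" by metis
    define q where "q = map (\<lambda>i. f (u i)) [0..<N]"
    \<comment> \<open>The list \<open>q\<close> has infinitely many indices, one for each second component \<open>m\<close>.\<close>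
    have "inj (\<lambda>m::nat. to_nat (q, m))" by (auto simp: inj_on_def)
    then have "infinite (range (\<lambda>m::nat. to_nat (q, m)))" by (rule range_inj_infinite)
    then obtain m where m: "to_nat (q, m::nat) \<ge> K"
      unfolding infinite_nat_iff_unbounded_le by blast
    define k where "k = to_nat (q, m)"
    have lk: "l k = q" by (simp add: l_def k_def)
    have yk: "norm (y k i - u i) \<le> (if i < N then d else 0)" for i
      using f[of "u i"] u(1) by (auto simp: y_def lk q_def norm_minus_commute)
    have "(\<Sum>m<M. norm (y k m - u m)) \<le> e / 2" for M
    proof -
      have "(\<Sum>m<M. norm (y k m - u m)) \<le> (\<Sum>m<M. if m < N then d else 0)"
        by (intro sum_mono yk)
      also have "\<dots> \<le> (\<Sum>m<max M N. if m < N then d else 0)"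
        using d by (intro sum_mono2) auto
      also have "\<dots> = (\<Sum>m<N. d)"
        by (intro sum.mono_neutral_cong_right) auto
      also have "\<dots> \<le> e / 2"
        using e by (simp add: d_def field_simps)
      finally show ?thesis .
    qed
    from l1_perturbation[OF X u(2) this] have "y k \<in> mspace X" "mdist X (y k) u \<le> e / 2"
      by auto
    then have "mdist X x (y k) < e"
      using triangle[OF x u(2), of "y k"] u(3) commute[of u "y k"] by simp
    then show "\<exists>k\<ge>K. mdist X x (y k) < e" using m by (auto simp: k_def)
  qed (use y0 in auto)
qed

section \<open>Universality and mixing in terms of distances\<close>

lemma universal_iff_approx:
  "universal X T \<longleftrightarrow> (\<exists>x\<in>mspace X. \<forall>y\<in>mspace X. \<forall>e>0.
     \<exists>n\<ge>1. T n x \<in> mspace X \<and> mdist X y (T n x) < e)"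
proof -
  interpret Metric_space "mspace X" "mdist X" by simp
  have "mtopology closure_of {T n x |n. n \<ge> 1} = mspace X \<longleftrightarrow>
      (\<forall>y\<in>mspace X. \<forall>e>0. \<exists>n\<ge>1. T n x \<in> mspace X \<and> mdist X y (T n x) < e)" for x
  proof -
    have "mtopology closure_of {T n x |n. n \<ge> 1} = mspace X \<longleftrightarrow>
        (\<forall>y\<in>mspace X. \<forall>e>0. \<exists>z\<in>{T n x |n. n \<ge> 1}. z \<in> mball y e)"
      unfolding metric_closure_of by blast
    also have "\<dots> \<longleftrightarrow> (\<forall>y\<in>mspace X. \<forall>e>0. \<exists>n\<ge>1. T n x \<in> mspace X \<and> mdist X y (T n x) < e)"
      by (intro ball_cong refl) auto
    finally show ?thesis .
  qed
  then show ?thesis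
    unfolding universal_def mtopology_of_def by simp
qed

lemma mixing_seq_iff_approx:
  "mixing_seq X T \<longleftrightarrow> (\<forall>x\<in>mspace X. \<forall>y\<in>mspace X. \<forall>e>0. \<exists>N\<ge>1. \<forall>n\<ge>N.
     \<exists>z\<in>mspace X. mdist X x z < e \<and> T n z \<in> mspace X \<and> mdist X y (T n z) < e)"
    (is "_ \<longleftrightarrow> ?R")
proof -
  interpret Metric_space "mspace X" "mdist X" by simp
  show ?thesis
  proof
    assume L: "mixing_seq X T"
    show ?R
    proof (intro ballI allI impI)
      fix x y and e :: real
      assume xy: "x \<in> mspace X" "y \<in> mspace X" and e: "e > 0"
      then have "x \<in> mball x e" "y \<in> mball y e" by auto
      then obtain N where "N \<ge> 1" "\<And>n. n \<ge> N \<Longrightarrow> T n ` mball x e \<inter> mball y e \<noteq> {}"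
        using L[unfolded mixing_seq_def mtopology_of_def] openin_mball by (metis empty_iff)
      then show "\<exists>N\<ge>1. \<forall>n\<ge>N. \<exists>z\<in>mspace X. mdist X x z < e \<and> T n z \<in> mspace X \<and> mdist X y (T n z) < e"
        by (intro exI[of _ N]) (fastforce simp: in_mball)
    qed
  next
    assume R: ?R
    show "mixing_seq X T"
      unfolding mixing_seq_def mtopology_of_def
    proof (intro allI impI, elim conjE)
      fix U V
      assume U: "openin mtopology U" "U \<noteq> {}" and V: "openin mtopology V" "V \<noteq> {}"
      obtain x y where xy: "x \<in> U" "y \<in> V" using U V by blast
      obtain r s where r: "r > 0" "mball x r \<subseteq> U" and s: "s > 0" "mball y s \<subseteq> V"
        using U V xy unfolding openin_mtopology by meson
      have xyX: "x \<in> mspace X" "y \<in> mspace X" using U V xy openin_mtopology by auto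
      have "min r s > 0" using r s by simp
      then obtain N where N: "N \<ge> 1" "\<And>n. n \<ge> N \<Longrightarrow> \<exists>z\<in>mspace X. mdist X x z < min r s \<and>
          T n z \<in> mspace X \<and> mdist X y (T n z) < min r s"
        using R xyX by meson
      have "T n ` U \<inter> V \<noteq> {}" if n: "n \<ge> N" for n
      proof -
        obtain z where "z \<in> mspace X" "mdist X x z < min r s" "T n z \<in> mspace X"
          "mdist X y (T n z) < min r s" using N(2)[OF n] by blast
        then have "z \<in> mball x r" "T n z \<in> mball y s" using xyX by auto
        then show ?thesis using r s by blast
      qed
      then show "\<exists>N\<ge>1. \<forall>n\<ge>N. T n ` U \<inter> V \<noteq> {}" using N(1) by blast
    qed
  qed
qed

section \<open>Scaled powers of a weighted shift and their right inverses\<close>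

definition weight_prod :: "(nat \<Rightarrow> 'k::comm_monoid_mult) \<Rightarrow> nat \<Rightarrow> 'k" where
  "weight_prod w n = (\<Prod>i=1..n. w i)"

lemma weight_prod_0 [simp]: "weight_prod w 0 = 1"
  by (simp add: weight_prod_def)

lemma weight_prod_Suc: "weight_prod w (Suc n) = weight_prod w n * w (Suc n)"
  by (simp add: weight_prod_def)

definition scaled_shift_powers ::
    "(nat \<Rightarrow> 'k::real_normed_field) \<Rightarrow> (nat \<Rightarrow> 'k) \<Rightarrow> nat \<Rightarrow> (nat \<Rightarrow> 'k) \<Rightarrow> nat \<Rightarrow> 'k" where
  "scaled_shift_powers a w n x = (\<lambda>i. a n * (weighted_shift w ^^ n) x i)"

lemma sum_shift_le: "(\<Sum>i<M. f (n + i)) \<le> (\<Sum>m<n + M. f m)" if "\<And>m. f m \<ge> 0" for f :: "nat \<Rightarrow> real"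
proof -
  have "(\<Sum>i<M. f (n + i)) = sum f {n..<n + M}"
    using sum.shift_bounds_nat_ivl[of f 0 n M] by (simp add: lessThan_atLeast0 add.commute)
  also have "\<dots> \<le> (\<Sum>m<n + M. f m)" using that by (intro sum_mono2) auto
  finally show ?thesis .
qed

lemma half_powers_tail: "k \<le> B \<Longrightarrow> (\<Sum>j\<in>{k<..B}. (1/2::real) ^ j) \<le> (1/2) ^ k"
proof -
  assume "k \<le> B"
  then have "(\<Sum>j\<in>{k<..B}. (1/2::real) ^ j) + (1/2) ^ B \<le> (1/2) ^ k"
  proof (induction B rule: dec_induct)
    case (step B)
    then have "{k<..Suc B} = insert (Suc B) {k<..B}" by auto
    then show ?case using step by simp
  qed simp
  moreover have "(1/2::real) ^ B \<ge> 0" by simp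
  ultimately show ?thesis by linarith
qed

text \<open>
  The factors decrease in modulus, and each weight product is at most \<open>C\<close> times the preceding one.
  Together these two conditions carry a lower bound for \<open>\<bar>a\<^sub>m W\<^sub>m\<bar>\<close> back to a lower bound for all the numbers
  \<open>\<bar>a\<^sub>n W\<^bsub>n+i\<^esub>\<bar>\<close> with \<open>n \<le> n + i \<le> m\<close>. The bound \<open>C \<ge> 1\<close> makes \<open>C\<^sup>n\<close> increasing in \<open>n\<close>.
\<close>

locale scaled_shifts =
  fixes w a :: "nat \<Rightarrow> 'k::{real_normed_field, euclidean_space}" and C :: real
  assumes weight_nonzero: "n \<ge> 1 \<Longrightarrow> w n \<noteq> 0"
    and C_ge_1: "C \<ge> 1" and weight_le: "n \<ge> 1 \<Longrightarrow> norm (w n) \<le> C"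
    and factor_nonzero: "a n \<noteq> 0"
    and factor_decreasing: "norm (a (Suc n)) \<le> norm (a n)"
begin

abbreviation W where "W \<equiv> weight_prod w"
abbreviation S where "S \<equiv> scaled_shift_powers a w"

definition right_inverse :: "nat \<Rightarrow> (nat \<Rightarrow> 'k) \<Rightarrow> nat \<Rightarrow> 'k" where
  "right_inverse n y m = (if m < n then 0 else W (m - n) * y (m - n) / (a n * W m))"

lemma W_nonzero: "W n \<noteq> 0"
  using weight_nonzero by (auto simp: weight_prod_def)

lemma W_add_le: "norm (W (n + i)) \<le> norm (W n) * C ^ i"
proof (induction i)
  case (Suc i)
  have "norm (W (n + Suc i)) = norm (W (n + i)) * norm (w (Suc (n + i)))"
    by (simp add: weight_prod_Suc norm_mult)
  also have "\<dots> \<le> norm (W n) * C ^ i * C"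
    using Suc weight_le C_ge_1 by (intro mult_mono) auto
  finally show ?case by (simp add: mult_ac)
qed simp

lemma factor_antimono: "m \<le> n \<Longrightarrow> norm (a n) \<le> norm (a m)"
  using factor_decreasing by (rule lift_Suc_antimono_le)

lemma shift_power: "(weighted_shift w ^^ n) x i * W i = W (n + i) * x (n + i)"
proof (induction n arbitrary: i)
  case (Suc n)
  have "(weighted_shift w ^^ Suc n) x i * W i = (weighted_shift w ^^ n) x (Suc i) * W (Suc i)"
    by (simp add: weighted_shift_def weight_prod_Suc)
  then show ?case using Suc[of "Suc i"] by simp
qed simp

text \<open>
  In the coordinates \<open>t\<^sub>m = W\<^sub>m x\<^sub>m\<close> the weighted shift is the unweighted one, and each power of it
  merely translates the index.
\<close>

lemma S_eq: "S n x i = a n * W (n + i) / W i * x (n + i)"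
  using shift_power[of n x i] W_nonzero[of i]
  by (simp add: scaled_shift_powers_def field_simps)

lemma S_sum: "S n (\<lambda>m. \<Sum>j\<in>J. u j m) i = (\<Sum>j\<in>J. S n (u j) i)"
  by (simp add: S_eq sum_distrib_left)

lemma S_right_inverse: "S n (right_inverse n y) = y"
  using W_nonzero factor_nonzero by (auto simp: S_eq right_inverse_def fun_eq_iff)

lemma norm_S_le: "norm (S n x i) \<le> (1 + norm (a 0)) * C ^ n * norm (x (n + i))"
proof -
  have "norm (S n x i) = norm (a n) * (norm (W (i + n)) / norm (W i)) * norm (x (n + i))"
    by (simp add: S_eq norm_mult norm_divide add.commute)
  also have "\<dots> \<le> (1 + norm (a 0)) * C ^ n * norm (x (n + i))"
    using factor_antimono[of 0 n] W_add_le[of i n] W_nonzero[of i] C_ge_1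
    by (intro mult_mono) (auto simp: divide_le_eq mult.commute)
  finally show ?thesis .
qed

lemma S_support: "\<forall>m\<ge>n. u m = 0 \<Longrightarrow> S n u i = 0"
  by (simp add: S_eq)

lemma right_inverse_support: "\<forall>i\<ge>L. y i = 0 \<Longrightarrow> m \<ge> n + L \<Longrightarrow> right_inverse n y m = 0"
  by (simp add: right_inverse_def)

text \<open>
  The index \<open>n + L\<close> lies past the support of \<open>R\<^sub>n y\<close>. Going back from it to \<open>n + i\<close> loses at most the
  factor \<open>C\<^sup>L\<close> in the weight product and nothing in the scalar factor, so that one large number
  \<open>\<bar>a\<^bsub>n+L\<^esub> W\<^bsub>n+L\<^esub>\<bar>\<close> controls all the coordinates of \<open>R\<^sub>n y\<close>.
\<close>

lemma right_inverse_small: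
  assumes y: "\<forall>i\<ge>L. y i = 0"
  shows "(\<Sum>m<M. norm (right_inverse n y m))
    \<le> (\<Sum>i<L. norm (W i * y i)) * C ^ L / norm (a (n + L) * W (n + L))"
proof -
  have le: "norm (right_inverse n y (n + i)) \<le> norm (W i * y i) * C ^ L / norm (a (n + L) * W (n + L))"
    if "i < L" for i
  proof -
    have "norm (a (n + L) * W (n + L)) \<le> norm (a n) * (norm (W (n + i)) * C ^ (L - i))"
      using factor_antimono[of n "n + L"] W_add_le[of "n + i" "L - i"] that
      by (auto simp: norm_mult intro!: mult_mono)
    also have "\<dots> \<le> norm (a n) * (norm (W (n + i)) * C ^ L)"
      using C_ge_1 by (intro mult_left_mono power_increasing) auto
    finally have "norm (a (n + L) * W (n + L)) / C ^ L \<le> norm (a n * W (n + i))"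
      using C_ge_1 by (simp add: divide_le_eq norm_mult mult.assoc)
    then have "norm (W i * y i) / norm (a n * W (n + i))
        \<le> norm (W i * y i) / (norm (a (n + L) * W (n + L)) / C ^ L)"
      using W_nonzero factor_nonzero C_ge_1 by (intro divide_left_mono) auto
    then show ?thesis by (simp add: right_inverse_def norm_divide)
  qed
  have "(\<Sum>m<M. norm (right_inverse n y m)) \<le> (\<Sum>m<max M (n + L). norm (right_inverse n y m))"
    by (intro sum_mono2) auto
  also have "\<dots> = (\<Sum>m=n..<n + L. norm (right_inverse n y m))"
    using right_inverse_support[OF y]
    by (intro sum.mono_neutral_right) (auto simp: right_inverse_def not_less)
  also have "\<dots> = (\<Sum>i<L. norm (right_inverse n y (n + i)))"
    using sum.shift_bounds_nat_ivl[of "\<lambda>m. norm (right_inverse n y m)" 0 n L]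
    by (simp add: lessThan_atLeast0 add.commute)
  also have "\<dots> \<le> (\<Sum>i<L. norm (W i * y i) * C ^ L / norm (a (n + L) * W (n + L)))"
    using le by (intro sum_mono) auto
  also have "\<dots> = (\<Sum>i<L. norm (W i * y i)) * C ^ L / norm (a (n + L) * W (n + L))"
    by (simp add: sum_distrib_right sum_divide_distrib)
  finally show ?thesis .
qed

lemma right_inverse_small_infinitely_often:
  assumes unb: "\<not> Bseq (\<lambda>n. a n * W n)" and y: "\<forall>i\<ge>L. y i = 0" and e: "e > 0"
  obtains n where "n \<ge> N" "\<And>M. (\<Sum>m<M. norm (right_inverse n y m)) \<le> e"
proof -
  define b where "b = (\<Sum>i<L. norm (W i * y i)) * C ^ L"
  have b0: "b \<ge> 0" using C_ge_1 by (auto simp: b_def intro!: mult_nonneg_nonneg sum_nonneg)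
  have "\<exists>m\<ge>N + L. norm (a m * W m) > b / e"
  proof (rule ccontr)
    assume "\<not> ?thesis"
    then have "\<forall>\<^sub>F m in sequentially. norm (a m * W m) \<le> b / e"
      by (auto simp: eventually_sequentially not_less)
    then show False using unb by (auto dest: BfunI)
  qed
  then obtain m where m: "m \<ge> N + L" "norm (a m * W m) > b / e" by blast
  show thesis
  proof (rule that[of "m - L"])
    fix M
    have "(\<Sum>q<M. norm (right_inverse (m - L) y q)) \<le> b / norm (a m * W m)"
      using right_inverse_small[OF y, of "m - L" M] m(1) by (simp add: b_def)
    also have "\<dots> \<le> e"
      using m(2) e b0 W_nonzero[of m] factor_nonzero[of m]
      by (simp add: divide_le_eq divide_less_eq mult.commute less_imp_le)
    finally show "(\<Sum>q<M. norm (right_inverse (m - L) y q)) \<le> e" .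
  qed (use m in auto)
qed

lemma right_inverse_small_eventually:
  assumes inf: "filterlim (\<lambda>n. a n * W n) at_infinity sequentially"
    and y: "\<forall>i\<ge>L. y i = 0" and e: "e > 0"
  shows "\<forall>\<^sub>F n in sequentially. \<forall>M. (\<Sum>m<M. norm (right_inverse n y m)) \<le> e"
proof -
  have "filterlim (\<lambda>n. norm (a (n + L) * W (n + L))) at_top sequentially"
    using filterlim_at_infinity_imp_norm_at_top[OF inf] filterlim_add_const_nat_at_top
    by (rule filterlim_compose)
  then have "(\<lambda>n. (\<Sum>i<L. norm (W i * y i)) * C ^ L / norm (a (n + L) * W (n + L))) \<longlonglongrightarrow> 0"
    by (rule real_tendsto_divide_at_top[OF tendsto_const])
  then have "\<forall>\<^sub>F n in sequentially.
      (\<Sum>i<L. norm (W i * y i)) * C ^ L / norm (a (n + L) * W (n + L)) < e"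
    using e by (rule order_tendstoD)
  then show ?thesis
    by eventually_elim (use right_inverse_small[OF y] in \<open>meson order_trans less_imp_le\<close>)
qed

end

section \<open>The criterion for universality and mixing\<close>

context scaled_shifts
begin

text \<open>
  The universal vector is \<open>x = \<Sum>\<^sub>k u\<^sub>k\<close> with \<open>u\<^sub>k = R\<^bsub>f(k)\<^esub> y\<^sub>k\<close>, the \<open>y\<^sub>k\<close> being the targets. The times
  \<open>f(k)\<close> are chosen one after the other, so that the supports of the \<open>u\<^sub>k\<close> are disjoint and move to the
  right, and so that \<open>u\<^sub>k\<close> is small even after multiplication by the norm bound of
  each earlier operator \<open>S\<^bsub>f(j)\<^esub>\<close>, \<open>j < k\<close>. Then \<open>S\<^bsub>f(k)\<^esub>\<close> annihilates the blocks before the \<open>k\<close>-th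
  one, sends that one to \<open>y\<^sub>k\<close>, and maps the later ones to vectors of total norm at most \<open>2\<^bsup>-k\<^esup>\<close>.
\<close>

lemma unbounded_imp_universal:
  assumes X: "X = c0_space \<or> (\<exists>p\<ge>1. X = lp_space p)"
    and unb: "\<not> Bseq (\<lambda>n. a n * W n)"
  shows "universal X S"
proof -
  \<comment> \<open>A bound for the norm of \<open>S n\<close>; the summand \<open>1\<close> ensures \<open>K n \<ge> 1\<close>.\<close>
  define K where "K n = (1 + norm (a 0)) * C ^ n" for n
  have K1: "K n \<ge> 1" for n
    unfolding K_def using C_ge_1 one_le_power[of C n] mult_mono[of 1 "1 + norm (a 0)" 1 "C ^ n"] by simp
  have Kmono: "K m \<le> K n" if "m \<le> n" for m n
    unfolding K_def using C_ge_1 that by (intro mult_left_mono power_increasing) auto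
  obtain y :: "nat \<Rightarrow> nat \<Rightarrow> 'k" and L
    where y0: "\<And>k i. i \<ge> L k \<Longrightarrow> y k i = 0"
      and dense: "\<And>x e K. x \<in> mspace X \<Longrightarrow> e > 0 \<Longrightarrow> \<exists>k\<ge>K. mdist X x (y k) < e"
    by (rule dense_target_sequence[OF X]) (rule that)
  have supp: "\<forall>i\<ge>L k. y k i = 0" for k using y0 by blast
  have "\<exists>f. \<forall>k. (f k \<ge> 1 \<and> (\<forall>M. (\<Sum>m<M. norm (right_inverse (f k) (y k) m)) \<le> (1/2) ^ k)) \<and>
      (f (Suc k) \<ge> f k + L k + 1 \<and>
       (\<forall>M. (\<Sum>m<M. norm (right_inverse (f (Suc k)) (y (Suc k)) m)) \<le> (1/2) ^ Suc k / K (f k)))"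
  proof (rule dependent_nat_choice)
    show "\<exists>n. n \<ge> 1 \<and> (\<forall>M. (\<Sum>m<M. norm (right_inverse n (y 0) m)) \<le> (1/2) ^ 0)"
      using right_inverse_small_infinitely_often[OF unb supp[of 0], of 1 1] by auto
  next
    fix n k
    have e: "(1/2) ^ Suc k / K n > 0" using K1[of n] by simp
    have le: "(1/2) ^ Suc k / K n \<le> (1/2) ^ Suc k"
      using K1[of n] divide_left_mono[of 1 "K n" "(1/2) ^ Suc k"] by simp
    obtain n' where n': "n' \<ge> n + L k + 1"
      "\<And>M. (\<Sum>m<M. norm (right_inverse n' (y (Suc k)) m)) \<le> (1/2) ^ Suc k / K n"
      using right_inverse_small_infinitely_often[OF unb supp[of "Suc k"] e, of "n + L k + 1"] by blast
    then show "\<exists>n'. (n' \<ge> 1 \<and> (\<forall>M. (\<Sum>m<M. norm (right_inverse n' (y (Suc k)) m)) \<le> (1/2) ^ Suc k)) \<and>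
        (n' \<ge> n + L k + 1 \<and> (\<forall>M. (\<Sum>m<M. norm (right_inverse n' (y (Suc k)) m)) \<le> (1/2) ^ Suc k / K n))"
      using order_trans[OF n'(2) le] by (intro exI[of _ n']) auto
  qed
  then obtain f where f1: "\<And>k. f k \<ge> 1"
      and small: "\<And>k M. (\<Sum>m<M. norm (right_inverse (f k) (y k) m)) \<le> (1/2) ^ k"
      and f_Suc: "\<And>k. f (Suc k) \<ge> f k + L k + 1"
      and smaller: "\<And>k M. (\<Sum>m<M. norm (right_inverse (f (Suc k)) (y (Suc k)) m)) \<le> (1/2) ^ Suc k / K (f k)"
    by blast
  have "strict_mono f"
  proof (rule strict_monoI_Suc)
    show "f k < f (Suc k)" for k using f_Suc[of k] by simp
  qed
  then have f_mono: "f j \<le> f k" if "j \<le> k" for j k using that by (simp add: strict_mono_less_eq)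
  have f_ge: "f k \<ge> k" for k using \<open>strict_mono f\<close> by (rule strict_mono_imp_increasing)
  define u where "u k = right_inverse (f k) (y k)" for k
  have u_low: "u k m = 0" if "m < f k" for k m
    using that by (simp add: u_def right_inverse_def)
  have u_high: "u j m = 0" if "j < k" "m \<ge> f k" for j k m
  proof -
    have "m \<ge> f j + L j" using f_Suc[of j] f_mono[of "Suc j" k] that by simp
    then show ?thesis unfolding u_def by (rule right_inverse_support[OF supp])
  qed
  have u_small: "K (f k) * (\<Sum>m<M. norm (u j m)) \<le> (1/2) ^ j" if "k < j" for k j M
  proof -
    obtain i where j: "j = Suc i" "k \<le> i" using \<open>k < j\<close> by (cases j) auto
    have "K (f k) * (\<Sum>m<M. norm (u j m)) \<le> K (f i) * ((1/2) ^ j / K (f i))"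
      using Kmono[OF f_mono[OF j(2)]] smaller[of i M] K1[of "f i"]
      by (intro mult_mono) (auto simp: u_def j(1) intro: sum_nonneg)
    then show ?thesis using K1[of "f i"] by simp
  qed
  \<comment> \<open>The blocks with index above \<open>m\<close> start after \<open>m\<close>, so this finite sum is the sum of all blocks.\<close>
  define x where "x m = (\<Sum>k\<le>m. u k m)" for m
  have x_eq: "x m = (\<Sum>k\<le>B. u k m)" if "m \<le> B" for m B
  proof -
    have "u k m = 0" if "k > m" for k using u_low[of m k] f_ge[of k] that by simp
    then show ?thesis unfolding x_def using that by (intro sum.mono_neutral_left) auto
  qed
  have xX: "x \<in> mspace X"
  proof (rule l1_perturbation(1)[OF X zero_in_mspace[OF X]])
    fix M
    have "(\<Sum>m<M. norm (x m - 0)) \<le> (\<Sum>m<M. \<Sum>k\<le>M. norm (u k m))"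
      using x_eq[of _ M] by (auto intro!: sum_mono norm_sum)
    also have "\<dots> = (\<Sum>k\<le>M. \<Sum>m<M. norm (u k m))" by (rule sum.swap)
    also have "\<dots> \<le> (\<Sum>k\<le>M. (1/2) ^ k)" using small by (auto simp: u_def intro!: sum_mono)
    also have "{..M} = insert 0 {0<..M}" by auto
    also have "(\<Sum>k\<in>\<dots>. (1/2::real) ^ k) \<le> 2" using half_powers_tail[of 0 M] by simp
    finally show "(\<Sum>m<M. norm (x m - 0)) \<le> 2" .
  qed
  have yX: "y k \<in> mspace X" for k using finite_support_in_mspace[OF X supp] .
  have err: "(\<Sum>i<M. norm (S (f k) x i - y k i)) \<le> (1/2) ^ k" for k M
  proof -
    define B where "B = f k + M"
    have kB: "k \<le> B" using f_ge[of k] by (simp add: B_def)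
    have diff: "S (f k) x i - y k i = (\<Sum>j\<in>{k<..B}. S (f k) (u j) i)" if "i < M" for i
    proof -
      have "S (f k) x i = S (f k) (\<lambda>m. \<Sum>j\<le>B. u j m) i"
        using x_eq[of "f k + i" B] that by (simp add: S_eq B_def)
      also have "\<dots> = (\<Sum>j\<le>B. S (f k) (u j) i)" by (rule S_sum)
      also have "\<dots> = (\<Sum>j\<in>{k..B}. S (f k) (u j) i)"
        using u_high[of _ k] by (intro sum.mono_neutral_right) (auto intro!: S_support simp: not_le)
      also have "{k..B} = insert k {k<..B}" using kB by auto
      also have "(\<Sum>j\<in>\<dots>. S (f k) (u j) i) = y k i + (\<Sum>j\<in>{k<..B}. S (f k) (u j) i)"
        by (simp add: u_def S_right_inverse)
      finally show ?thesis by simp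
    qed
    have "(\<Sum>i<M. norm (S (f k) x i - y k i)) \<le> (\<Sum>i<M. \<Sum>j\<in>{k<..B}. K (f k) * norm (u j (f k + i)))"
      using norm_S_le by (auto simp: diff K_def intro!: sum_mono sum_norm_le)
    also have "\<dots> = (\<Sum>j\<in>{k<..B}. K (f k) * (\<Sum>i<M. norm (u j (f k + i))))"
      by (subst sum.swap) (simp add: sum_distrib_left)
    also have "\<dots> \<le> (\<Sum>j\<in>{k<..B}. K (f k) * (\<Sum>m<f k + M. norm (u j m)))"
      using K1[of "f k"] by (intro sum_mono mult_left_mono sum_shift_le) auto
    also have "\<dots> \<le> (\<Sum>j\<in>{k<..B}. (1/2) ^ j)" using u_small by (intro sum_mono) auto
    also have "\<dots> \<le> (1/2) ^ k" using kB by (rule half_powers_tail)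
    finally show ?thesis .
  qed
  note near = l1_perturbation[OF X yX err]
  show ?thesis
    unfolding universal_iff_approx
  proof (intro bexI[OF _ xX] ballI allI impI)
    fix z and e :: real
    assume z: "z \<in> mspace X" and e: "e > 0"
    interpret Metric_space "mspace X" "mdist X" by simp
    obtain k0 where k0: "(1/2::real) ^ k0 < e / 2"
      using real_arch_pow_inv[of "e / 2" "1/2"] e by auto
    obtain k where k: "k \<ge> k0" "mdist X z (y k) < e / 2" using dense[OF z, of "e / 2" k0] e by auto
    have "mdist X z (S (f k) x) \<le> mdist X z (y k) + mdist X (y k) (S (f k) x)"
      using z yX near(1) by (rule triangle)
    also have "mdist X (y k) (S (f k) x) \<le> (1/2) ^ k"
      using near(2)[of k] by (simp add: commute)
    also have "(1/2::real) ^ k \<le> (1/2) ^ k0" using k(1) by (intro power_decreasing) auto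
    finally have "mdist X z (S (f k) x) < e" using k0 k(2) by simp
    then show "\<exists>n\<ge>1. S n x \<in> mspace X \<and> mdist X z (S n x) < e"
      using f1 near(1) by blast
  qed
qed

lemma S_at_0: "S n x 0 = a n * W n * x n"
  by (simp add: S_eq)

text \<open>
  If \<open>a\<^sub>n W\<^sub>n\<close> is bounded, the coordinate \<open>0\<close> stays bounded along each orbit, and some multiple of the
  first basis vector keeps a distance from the whole orbit.
\<close>

lemma universal_imp_unbounded:
  assumes X: "X = c0_space \<or> (\<exists>p\<ge>1. X = lp_space p)" and univ: "universal X S"
  shows "\<not> Bseq (\<lambda>n. a n * W n)"
proof
  assume "Bseq (\<lambda>n. a n * W n)"
  then obtain B where B: "B > 0" "\<And>n. norm (a n * W n) \<le> B" by (auto elim: BseqE)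
  obtain x where x: "x \<in> mspace X"
    and dense: "\<And>y e. y \<in> mspace X \<Longrightarrow> e > 0 \<Longrightarrow> \<exists>n\<ge>1. S n x \<in> mspace X \<and> mdist X y (S n x) < e"
    using univ unfolding universal_iff_approx by blast
  define r where "r = mdist X x (\<lambda>_. 0)"
  have r: "norm (x n) \<le> r" for n
    using coord_le_mdist[OF X x zero_in_mspace[OF X], of n] by (simp add: r_def)
  have r0: "r \<ge> 0" using r[of 0] norm_ge_zero order_trans by blast
  define y :: "nat \<Rightarrow> 'k" where "y i = (if i = 0 then of_real (B * r + 1) else 0)" for i
  have y: "y \<in> mspace X" using finite_support_in_mspace[OF X, of 1 y] by (simp add: y_def)
  obtain n where n: "S n x \<in> mspace X" "mdist X y (S n x) < 1" using dense[OF y, of 1] by auto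
  have "norm (y 0 - S n x 0) < 1" using coord_le_mdist[OF X y n(1), of 0] n(2) by simp
  moreover have "norm (S n x 0) \<le> B * r"
    using B r[of n] unfolding S_at_0 norm_mult[of _ "x n"] by (intro mult_mono) auto
  moreover have "norm (y 0) = B * r + 1" using B r0 by (simp add: y_def del: of_real_add of_real_mult)
  ultimately show False using norm_triangle_ineq2[of "y 0" "S n x 0"] by linarith
qed

theorem universal_iff_unbounded:
  assumes "X = c0_space \<or> (\<exists>p\<ge>1. X = lp_space p)"
  shows "universal X S \<longleftrightarrow> \<not> Bseq (\<lambda>n. a n * W n)"
  using unbounded_imp_universal universal_imp_unbounded assms by blast

text \<open>
  For finitely supported \<open>x\<close> and \<open>y\<close>, the vector \<open>z = x + R\<^sub>n y\<close> is near \<open>x\<close> when \<open>n\<close> is large,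
  and \<open>S\<^sub>n z = y\<close> as soon as \<open>n\<close> exceeds the support of \<open>x\<close>.
\<close>

lemma at_infinity_imp_mixing:
  assumes X: "X = c0_space \<or> (\<exists>p\<ge>1. X = lp_space p)"
    and inf: "filterlim (\<lambda>n. a n * W n) at_infinity sequentially"
  shows "mixing_seq X S"
  unfolding mixing_seq_iff_approx
proof (intro ballI allI impI)
  fix x y and e :: real
  assume x: "x \<in> mspace X" and y: "y \<in> mspace X" and e: "e > 0"
  interpret Metric_space "mspace X" "mdist X" by simp
  obtain N x' where x': "\<forall>i\<ge>N. x' i = 0" "x' \<in> mspace X" "mdist X x x' < e / 2"
    using finite_support_dense[OF X x, of "e / 2"] e by auto
  obtain L y' where y': "\<forall>i\<ge>L. y' i = 0" "y' \<in> mspace X" "mdist X y y' < e"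
    using finite_support_dense[OF X y e] by auto
  have "\<forall>\<^sub>F n in sequentially. \<forall>M. (\<Sum>m<M. norm (right_inverse n y' m)) \<le> e / 2"
    using right_inverse_small_eventually[OF inf y'(1), of "e / 2"] e by simp
  then obtain N' where N': "\<And>n M. n \<ge> N' \<Longrightarrow> (\<Sum>m<M. norm (right_inverse n y' m)) \<le> e / 2"
    by (auto simp: eventually_sequentially)
  have "\<exists>z\<in>mspace X. mdist X x z < e \<and> S n z \<in> mspace X \<and> mdist X y (S n z) < e"
    if n: "n \<ge> max 1 (max N N')" for n
  proof -
    define z where "z m = x' m + right_inverse n y' m" for m
    have "(\<Sum>m<M. norm (z m - x' m)) \<le> e / 2" for M
      using N'[of n M] n by (simp add: z_def)
    from l1_perturbation[OF X x'(2) this] have z: "z \<in> mspace X" "mdist X z x' \<le> e / 2" by auto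
    then have "mdist X x z < e"
      using triangle[OF x x'(2) z(1)] x'(3) commute[of x' z] by simp
    moreover have "S n z = y'"
    proof
      fix i
      have "S n z i = S n x' i + S n (right_inverse n y') i" by (simp add: S_eq z_def distrib_left)
      then show "S n z i = y' i" using S_support[of n x' i] x'(1) n by (simp add: S_right_inverse)
    qed
    ultimately show ?thesis using z(1) y' by auto
  qed
  then show "\<exists>N\<ge>1. \<forall>n\<ge>N. \<exists>z\<in>mspace X. mdist X x z < e \<and> S n z \<in> mspace X \<and> mdist X y (S n z) < e"
    by (intro exI[of _ "max 1 (max N N')"]) auto
qed

text \<open>
  A vector \<open>z\<close> within distance \<open>1\<close> of the origin whose image is within distance \<open>1\<close> of
  \<open>(\<bar>Z\<bar> + 1) e\<^sub>0\<close> forces \<open>\<bar>a\<^sub>n W\<^sub>n\<bar>\<close> to be at least \<open>Z\<close>, because \<open>\<bar>a\<^sub>n W\<^sub>n z\<^sub>n\<bar>\<close> is the modulus of the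
  coordinate \<open>0\<close> of the image.
\<close>

lemma mixing_imp_at_infinity:
  assumes X: "X = c0_space \<or> (\<exists>p\<ge>1. X = lp_space p)" and mix: "mixing_seq X S"
  shows "filterlim (\<lambda>n. a n * W n) at_infinity sequentially"
  unfolding filterlim_at_infinity_conv_norm_at_top filterlim_at_top
proof
  fix Z :: real
  define y :: "nat \<Rightarrow> 'k" where "y i = (if i = 0 then of_real (\<bar>Z\<bar> + 1) else 0)" for i
  have y: "y \<in> mspace X" using finite_support_in_mspace[OF X, of 1 y] by (simp add: y_def)
  obtain N where N: "\<And>n. n \<ge> N \<Longrightarrow> \<exists>z\<in>mspace X. mdist X (\<lambda>_. 0) z < 1 \<and> S n z \<in> mspace X \<and> mdist X y (S n z) < 1"
    using mix y zero_in_mspace[OF X] unfolding mixing_seq_iff_approx by (meson zero_less_one)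
  have "Z \<le> norm (a n * W n)" if n: "n \<ge> N" for n
  proof -
    obtain z where z: "z \<in> mspace X" "mdist X (\<lambda>_. 0) z < 1" "S n z \<in> mspace X" "mdist X y (S n z) < 1"
      using N[OF n] by blast
    have "norm (z n) \<le> 1" using coord_le_mdist[OF X zero_in_mspace[OF X] z(1), of n] z(2) by simp
    then have "norm (S n z 0) \<le> norm (a n * W n)"
      unfolding S_at_0 norm_mult[of _ "z n"] by (intro mult_left_le) auto
    moreover have "norm (y 0 - S n z 0) < 1" using coord_le_mdist[OF X y z(3), of 0] z(4) by simp
    moreover have "norm (y 0) = \<bar>Z\<bar> + 1" by (simp add: y_def del: of_real_add)
    ultimately show ?thesis using norm_triangle_ineq2[of "y 0" "S n z 0"] by linarith
  qed
  then show "\<forall>\<^sub>F n in sequentially. Z \<le> norm (a n * W n)" by (auto simp: eventually_sequentially)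
qed

theorem mixing_iff_at_infinity:
  assumes "X = c0_space \<or> (\<exists>p\<ge>1. X = lp_space p)"
  shows "mixing_seq X S \<longleftrightarrow> filterlim (\<lambda>n. a n * W n) at_infinity sequentially"
  using at_infinity_imp_mixing mixing_imp_at_infinity assms by blast

end

lemma admissible_scaled_shifts:
  fixes w a :: "nat \<Rightarrow> 'k::{real_normed_field, euclidean_space}"
  assumes w: "admissible_weights w"
    and a: "\<And>n. a n \<noteq> 0" "\<And>n. norm (a (Suc n)) \<le> norm (a n)"
  obtains C where "scaled_shifts w a C"
proof -
  obtain C where C: "\<And>n. n \<ge> 1 \<Longrightarrow> norm (w n) \<le> C"
    using w unfolding admissible_weights_def bounded_iff by fastforce
  have "scaled_shifts w a (max C 1)"
    using w a C by unfold_locales (auto simp: admissible_weights_def le_max_iff_disj)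
  then show ?thesis by (rule that)
qed

lemma
  fixes w a :: "nat \<Rightarrow> 'k::{real_normed_field, euclidean_space}"
  assumes X: "X = c0_space \<or> (\<exists>p\<ge>1. X = lp_space p)" and w: "admissible_weights w"
    and a: "\<And>n. a n \<noteq> 0" "\<And>n. norm (a (Suc n)) \<le> norm (a n)"
  shows universal_scaled_shift_powers_iff:
      "universal X (scaled_shift_powers a w) \<longleftrightarrow> \<not> Bseq (\<lambda>n. a n * weight_prod w n)"
    and mixing_scaled_shift_powers_iff:
      "mixing_seq X (scaled_shift_powers a w) \<longleftrightarrow>
        filterlim (\<lambda>n. a n * weight_prod w n) at_infinity sequentially"
proof -
  obtain C where "scaled_shifts w a C" using admissible_scaled_shifts[where a = a, OF w a] .
  then interpret scaled_shifts w a C .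
  show "universal X (scaled_shift_powers a w) \<longleftrightarrow> \<not> Bseq (\<lambda>n. a n * weight_prod w n)"
    using X by (rule universal_iff_unbounded)
  show "mixing_seq X (scaled_shift_powers a w) \<longleftrightarrow>
        filterlim (\<lambda>n. a n * weight_prod w n) at_infinity sequentially"
    using X by (rule mixing_iff_at_infinity)
qed

lemma
  fixes w :: "nat \<Rightarrow> 'k::{real_normed_field, euclidean_space}"
  assumes X: "X = c0_space \<or> (\<exists>p\<ge>1. X = lp_space p)" and w: "admissible_weights w"
  shows hypercyclic_weighted_shift_iff:
      "hypercyclic X (weighted_shift w) \<longleftrightarrow> \<not> Bseq (weight_prod w)"
    and mixing_weighted_shift_iff:
      "mixing X (weighted_shift w) \<longleftrightarrow> filterlim (weight_prod w) at_infinity sequentially"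
proof -
  have "scaled_shift_powers (\<lambda>_. 1) w = (\<lambda>n. weighted_shift w ^^ n)"
    by (simp add: scaled_shift_powers_def fun_eq_iff)
  then show "hypercyclic X (weighted_shift w) \<longleftrightarrow> \<not> Bseq (weight_prod w)"
      "mixing X (weighted_shift w) \<longleftrightarrow> filterlim (weight_prod w) at_infinity sequentially"
    using universal_scaled_shift_powers_iff[OF X w, of "\<lambda>_. 1"]
      mixing_scaled_shift_powers_iff[OF X w, of "\<lambda>_. 1"]
    by (simp_all add: hypercyclic_def mixing_def)
qed

section \<open>Random products of commuting shifts\<close>

definition visits :: "('o \<Rightarrow> 'o) \<Rightarrow> 'o set \<Rightarrow> nat \<Rightarrow> 'o \<Rightarrow> nat" where
  "visits \<tau> A n \<omega> = card {j. j < n \<and> (\<tau> ^^ j) \<omega> \<in> A}"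

lemma visits_0 [simp]: "visits \<tau> A 0 \<omega> = 0"
  by (simp add: visits_def)

lemma visits_Suc: "visits \<tau> A (Suc n) \<omega> = visits \<tau> A n \<omega> + (if (\<tau> ^^ n) \<omega> \<in> A then 1 else 0)"
proof -
  have "{j. j < Suc n \<and> (\<tau> ^^ j) \<omega> \<in> A} =
      (if (\<tau> ^^ n) \<omega> \<in> A then insert n else id) {j. j < n \<and> (\<tau> ^^ j) \<omega> \<in> A}"
    by (auto simp: less_Suc_eq)
  then show ?thesis by (simp add: visits_def)
qed

lemma visits_mono: "m \<le> n \<Longrightarrow> visits \<tau> A m \<omega> \<le> visits \<tau> A n \<omega>"
  unfolding visits_def by (intro card_mono) auto

lemma visits_le: "visits \<tau> A n \<omega> \<le> n"
  by (induction n) (auto simp: visits_Suc)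

lemma visits_unbounded:
  assumes "\<exists>\<^sub>\<infinity>n. (\<tau> ^^ n) \<omega> \<in> A"
  shows "\<exists>n. visits \<tau> A n \<omega> \<ge> k"
proof (induction k)
  case (Suc k)
  then obtain n where n: "visits \<tau> A n \<omega> \<ge> k" by blast
  obtain m where m: "m \<ge> n" "(\<tau> ^^ m) \<omega> \<in> A" using assms unfolding INFM_nat_le by blast
  have "visits \<tau> A (Suc m) \<omega> \<ge> Suc k"
    using n m(2) visits_mono[OF m(1), of \<tau> A \<omega>] by (simp add: visits_Suc)
  then show ?case by blast
qed simp

text \<open>
  Evaluating both products at the basis vector \<open>e\<^bsub>n+1\<^esub>\<close> gives \<open>w\<^sub>n v\<^bsub>n+1\<^esub> = v\<^sub>n w\<^bsub>n+1\<^esub>\<close>, so that the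
  quotient \<open>v\<^sub>n / w\<^sub>n\<close> does not depend on \<open>n\<close>.
\<close>

lemma commuting_shifts_proportional:
  fixes X :: "(nat \<Rightarrow> 'k::real_normed_field) metric"
  assumes X: "X = c0_space \<or> (\<exists>p\<ge>1. X = lp_space p)"
    and w: "admissible_weights w" and comm: "commute_on X (weighted_shift w) (weighted_shift v)"
    and n: "n \<ge> 1"
  shows "v n = v 1 / w 1 * w n"
  using n
proof (induction n rule: nat_induct_at_least)
  case base
  then show ?case using w by (simp add: admissible_weights_def)
next
  case (Suc n)
  have "basis_seq (Suc n) \<in> mspace X"
    using finite_support_in_mspace[OF X, of "Suc (Suc n)" "basis_seq (Suc n)"]
    by (simp add: basis_seq_def)
  then have "weighted_shift w (weighted_shift v (basis_seq (Suc n))) (n - 1) =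
      weighted_shift v (weighted_shift w (basis_seq (Suc n))) (n - 1)"
    using comm by (simp add: commute_on_def)
  then have "w n * v (Suc n) = v n * w (Suc n)"
    using Suc(1) by (simp add: weighted_shift_def basis_seq_def)
  moreover have "w n \<noteq> 0" "w 1 \<noteq> 0" using w Suc(1) by (auto simp: admissible_weights_def)
  ultimately show ?case using Suc(2) by (simp add: field_simps)
qed

text \<open>
  Since \<open>B\<^sub>v = c B\<^sub>w\<close>, the order of the factors is irrelevant and only the number of times at which
  \<open>B\<^sub>v\<close> is applied matters.
\<close>

lemma random_shift_seq_eq:
  fixes w v :: "nat \<Rightarrow> 'k::real_normed_field"
  assumes v: "\<And>n. n \<ge> 1 \<Longrightarrow> v n = c * w n"
  shows "random_shift_seq \<tau> A w v \<omega> = scaled_shift_powers (\<lambda>n. c ^ visits \<tau> (- A) n \<omega>) w"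
proof -
  have vw: "weighted_shift v x = (\<lambda>i. c * weighted_shift w x i)" for x
    using v by (simp add: weighted_shift_def fun_eq_iff)
  have "random_product (random_shift A w v) \<tau> n \<omega> x
      = (\<lambda>i. c ^ visits \<tau> (- A) n \<omega> * (weighted_shift w ^^ n) x i)" for n x
  proof (induction n)
    case (Suc n)
    have "weighted_shift w (\<lambda>i. d * z i) = (\<lambda>i. d * weighted_shift w z i)" for d z
      by (simp add: weighted_shift_def mult_ac)
    then show ?case
      using Suc by (simp add: random_shift_def visits_Suc vw mult.assoc)
  qed simp
  then show ?thesis by (simp add: fun_eq_iff random_shift_seq_def scaled_shift_powers_def)
qed

lemma Bseq_norm_le:
  assumes "Bseq g" "\<And>n. norm (f n) \<le> norm (g n)"
  shows "Bseq f"
  using assms by (auto simp: Bseq_def intro: order_trans)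

lemma at_infinity_norm_le:
  assumes "filterlim f at_infinity F" "\<And>n. norm (f n) \<le> norm (g n)"
  shows "filterlim g at_infinity F"
  using assms(1) unfolding filterlim_at_infinity_conv_norm_at_top
  by (rule filterlim_at_top_mono) (simp add: assms(2))

lemma weight_prod_scaled:
  fixes w :: "nat \<Rightarrow> 'k::comm_semiring_1"
  assumes "\<And>n. n \<ge> 1 \<Longrightarrow> v n = c * w n"
  shows "weight_prod v n = c ^ n * weight_prod w n"
  by (induction n) (simp_all add: weight_prod_Suc assms mult_ac)

text \<open>
  With \<open>v = c w\<close> and \<open>\<bar>c\<bar> < 1\<close>, the three sequences \<open>c\<^sup>n W\<^sub>n\<close>, \<open>c\<^bsup>k(n)\<^esup> W\<^sub>n\<close> and \<open>W\<^sub>n\<close>, which decide on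
  \<open>B\<^sub>v\<close>, on the random product and on \<open>B\<^sub>w\<close>, increase in modulus in this order.
\<close>

theorem random_shift_between:
  fixes X :: "(nat \<Rightarrow> 'k::{real_normed_field, euclidean_space}) metric"
  assumes X: "X = c0_space \<or> (\<exists>p\<ge>1. X = lp_space p)"
    and w: "admissible_weights w" and v: "admissible_weights v"
    and comm: "commute_on X (weighted_shift w) (weighted_shift v)" and less: "norm (w 1) > norm (v 1)"
  shows "hypercyclic X (weighted_shift v) \<Longrightarrow> universal X (random_shift_seq \<tau> A w v \<omega>)"
    and "universal X (random_shift_seq \<tau> A w v \<omega>) \<Longrightarrow> hypercyclic X (weighted_shift w)"
    and "mixing X (weighted_shift v) \<Longrightarrow> mixing_seq X (random_shift_seq \<tau> A w v \<omega>)"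
    and "mixing_seq X (random_shift_seq \<tau> A w v \<omega>) \<Longrightarrow> mixing X (weighted_shift w)"
proof -
  define c where "c = v 1 / w 1"
  have vc: "v n = c * w n" if "n \<ge> 1" for n
    using commuting_shifts_proportional[OF X w comm that] by (simp add: c_def)
  have c: "c \<noteq> 0" "norm c < 1"
    using less w v by (auto simp: c_def admissible_weights_def norm_divide)
  define a where "a n = c ^ visits \<tau> (- A) n \<omega>" for n
  have a0: "a n \<noteq> 0" for n using c by (simp add: a_def)
  have dec: "norm (a (Suc n)) \<le> norm (a n)" for n
    using c visits_mono[of n "Suc n" \<tau> "- A" \<omega>] by (simp add: a_def norm_power power_decreasing)
  have T: "random_shift_seq \<tau> A w v \<omega> = scaled_shift_powers a w"
    unfolding a_def using vc by (rule random_shift_seq_eq)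
  have upper: "norm (a n * weight_prod w n) \<le> norm (weight_prod w n)" for n
    using c by (auto simp: a_def norm_mult norm_power intro!: mult_left_le_one_le power_le_one)
  have lower: "norm (weight_prod v n) \<le> norm (a n * weight_prod w n)" for n
    using c visits_le[of \<tau> "- A" n \<omega>]
    by (auto simp: weight_prod_scaled[of v c w, OF vc] a_def norm_mult norm_power
        intro!: mult_right_mono power_decreasing)
  note criteria = T universal_scaled_shift_powers_iff[where a = a, OF X w a0 dec]
    mixing_scaled_shift_powers_iff[where a = a, OF X w a0 dec]
    hypercyclic_weighted_shift_iff[OF X w] hypercyclic_weighted_shift_iff[OF X v]
    mixing_weighted_shift_iff[OF X w] mixing_weighted_shift_iff[OF X v]
  show "hypercyclic X (weighted_shift v) \<Longrightarrow> universal X (random_shift_seq \<tau> A w v \<omega>)"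
    unfolding criteria by (erule contrapos_nn) (erule Bseq_norm_le, rule lower)
  show "universal X (random_shift_seq \<tau> A w v \<omega>) \<Longrightarrow> hypercyclic X (weighted_shift w)"
    unfolding criteria by (erule contrapos_nn) (erule Bseq_norm_le, rule upper)
  show "mixing X (weighted_shift v) \<Longrightarrow> mixing_seq X (random_shift_seq \<tau> A w v \<omega>)"
    unfolding criteria by (erule at_infinity_norm_le) (rule lower)
  show "mixing_seq X (random_shift_seq \<tau> A w v \<omega>) \<Longrightarrow> mixing X (weighted_shift w)"
    unfolding criteria by (erule at_infinity_norm_le) (rule upper)
qed

section \<open>Visits to a set in an ergodic system\<close>

lemma iterate_measurable:
  "\<tau> \<in> measurable M M \<Longrightarrow> \<tau> ^^ n \<in> measurable M M"
  by (induction n) (auto intro: measurable_comp measurable_ident simp: id_def)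

lemma iterate_preimage_measure:
  assumes sys: "measure_preserving_system M \<tau>" and A: "A \<in> sets M"
  shows "measure M ((\<tau> ^^ n) -` A \<inter> space M) = measure M A"
proof (induction n)
  case 0
  show ?case using sets.sets_into_space[OF A] by (simp add: Int_absorb2)
next
  case (Suc n)
  have \<tau>: "\<tau> \<in> measurable M M" using sys by (simp add: measure_preserving_system_def)
  have "(\<tau> ^^ Suc n) -` A \<inter> space M = \<tau> -` ((\<tau> ^^ n) -` A \<inter> space M) \<inter> space M"
    using measurable_space[OF \<tau>] by (auto simp: funpow_swap1)
  moreover have "measure M (\<tau> -` ((\<tau> ^^ n) -` A \<inter> space M) \<inter> space M)
      = measure M ((\<tau> ^^ n) -` A \<inter> space M)"
    using sys measurable_sets[OF iterate_measurable[OF \<tau>] A]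
    unfolding measure_preserving_system_def by blast
  ultimately show ?case using Suc by (simp only:)
qed

text \<open>
  The set \<open>B\<close> of the points that visit \<open>A\<close> infinitely often is strictly invariant, hence of measure
  \<open>0\<close> or \<open>1\<close>. It is the decreasing limit of the sets of points that visit \<open>A\<close> at some time after
  \<open>N\<close>, and each of these contains a preimage of \<open>A\<close>, of the same measure as
  \<open>A\<close>; thus the measure of \<open>B\<close> is at least that of \<open>A\<close>, which is positive.
\<close>

lemma ergodic_visits_infinitely_often:
  assumes erg: "ergodic_system M \<tau>" and A: "A \<in> sets M" "measure M A > 0"
  shows "AE \<omega> in M. \<exists>\<^sub>\<infinity>n. (\<tau> ^^ n) \<omega> \<in> A"
proof -
  have sys: "measure_preserving_system M \<tau>" using erg by (simp add: ergodic_system_def)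
  then have \<tau>: "\<tau> \<in> measurable M M" and "prob_space M"
    by (auto simp: measure_preserving_system_def)
  interpret prob_space M by fact
  define E where "E n = (\<tau> ^^ n) -` A \<inter> space M" for n
  define F where "F N = (\<Union>n\<in>{N..}. E n)" for N
  define B where "B = (\<Inter>N. F N)"
  have E: "E n \<in> sets M" for n
    unfolding E_def using iterate_measurable[OF \<tau>] A(1) by (rule measurable_sets)
  have F: "F N \<in> sets M" for N unfolding F_def using E by (intro sets.countable_UN') auto
  have B: "B \<in> sets M" unfolding B_def using F by (intro sets.countable_INT) auto
  have B_iff: "\<omega> \<in> B \<longleftrightarrow> \<omega> \<in> space M \<and> (\<exists>\<^sub>\<infinity>n. (\<tau> ^^ n) \<omega> \<in> A)" for \<omega>
    by (auto simp: B_def F_def E_def INFM_nat_le Bex_def)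
  have "\<tau> -` B \<inter> space M = B"
  proof -
    have "(\<exists>\<^sub>\<infinity>n. (\<tau> ^^ n) (\<tau> \<omega>) \<in> A) \<longleftrightarrow> (\<exists>\<^sub>\<infinity>n. (\<tau> ^^ n) \<omega> \<in> A)" for \<omega>
    proof -
      have "(\<exists>\<^sub>\<infinity>n. (\<tau> ^^ n) (\<tau> \<omega>) \<in> A) \<longleftrightarrow> (\<exists>\<^sub>\<infinity>n. (\<tau> ^^ Suc n) \<omega> \<in> A)"
        by (simp add: funpow_swap1)
      also have "\<dots> \<longleftrightarrow> (\<exists>\<^sub>\<infinity>n. (\<tau> ^^ n) \<omega> \<in> A)"
        unfolding frequently_def eventually_sequentially_Suc[of "\<lambda>n. (\<tau> ^^ n) \<omega> \<notin> A", symmetric]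
          cofinite_eq_sequentially ..
      finally show ?thesis .
    qed
    then show ?thesis using measurable_space[OF \<tau>] by (auto simp: B_iff)
  qed
  then have "prob B \<in> {0, 1}" using erg B by (simp add: ergodic_system_def)
  moreover have "prob A \<le> prob B"
  proof (rule LIMSEQ_le_const)
    show "(\<lambda>N. prob (F N)) \<longlonglongrightarrow> prob B"
      unfolding B_def
    proof (rule finite_Lim_measure_decseq)
      show "decseq F" unfolding F_def by (intro antimonoI UN_mono) auto
    qed (use F in auto)
    have "prob A \<le> prob (F N)" for N
    proof -
      have "prob A = prob (E N)" using iterate_preimage_measure[OF sys A(1)] by (simp add: E_def)
      also have "\<dots> \<le> prob (F N)" using F by (intro finite_measure_mono) (auto simp: F_def)
      finally show ?thesis .
    qed
    then show "\<exists>N. \<forall>n\<ge>N. prob A \<le> prob (F n)" by blast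
  qed
  ultimately have "prob B = 1" using A(2) by auto
  then have "AE \<omega> in M. \<omega> \<in> B" using B prob_eq_1 by blast
  then show ?thesis by eventually_elim (simp add: B_iff)
qed

lemma visits_measurable:
  assumes \<tau>: "\<tau> \<in> measurable M M" and A: "A \<in> sets M"
  shows "visits \<tau> A n \<in> measurable M (count_space UNIV)"
proof (induction n)
  case (Suc n)
  have "Measurable.pred M (\<lambda>\<omega>. (\<tau> ^^ n) \<omega> \<in> A)"
    using A iterate_measurable[OF \<tau>] by (rule pred_sets2)
  then have "(\<lambda>\<omega>. visits \<tau> A n \<omega> + (if (\<tau> ^^ n) \<omega> \<in> A then 1 else 0)) \<in> measurable M (count_space UNIV)"
    using Suc by measurable
  then show ?case by (simp add: visits_Suc[abs_def])
qed (simp add: visits_def[abs_def])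

text \<open>
  For fixed \<open>j\<close> the events \<open>k\<^sub>n < j\<close> decrease to a null set, so one of them has probability less than
  \<open>2\<^bsup>-j\<^esup>\<close>. The Borel--Cantelli lemma turns these choices into an almost sure statement.
\<close>

lemma (in prob_space) sparse_lower_bound:
  fixes k :: "nat \<Rightarrow> 'a \<Rightarrow> nat"
  assumes meas: "\<And>n. k n \<in> measurable M (count_space UNIV)"
    and mono: "\<And>m n \<omega>. m \<le> n \<Longrightarrow> k m \<omega> \<le> k n \<omega>"
    and unb: "AE \<omega> in M. \<forall>j. \<exists>n. k n \<omega> \<ge> j"
  obtains r where "strict_mono r" "AE \<omega> in M. \<forall>\<^sub>F j in sequentially. k (r j) \<omega> \<ge> j"
proof -
  define B where "B j n = {\<omega>\<in>space M. k n \<omega> < j}" for j n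
  have B: "B j n \<in> sets M" for j n
    using measurable_sets[OF meas, of "{..<j}" n] by (simp add: B_def vimage_def Int_def conj_commute)
  have B_anti: "B j n \<subseteq> B j m" if "m \<le> n" for j m n
    using mono[OF that] by (auto simp: B_def intro: le_less_trans)
  have "\<exists>N. prob (B j N) < (1/2) ^ j" for j
  proof -
    have "AE \<omega> in M. \<omega> \<notin> (\<Inter>n. B j n)"
      using unb by eventually_elim (auto simp: B_def not_less)
    then have "prob (\<Inter>n. B j n) = 0"
      using B by (intro prob_eq_0[THEN iffD2]) auto
    moreover have "(\<lambda>n. prob (B j n)) \<longlonglongrightarrow> prob (\<Inter>n. B j n)"
      using B B_anti by (intro finite_Lim_measure_decseq) (auto simp: decseq_def)
    ultimately have "\<forall>\<^sub>F n in sequentially. prob (B j n) < (1/2) ^ j"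
      by (intro order_tendstoD(2)[where y = 0]) auto
    then show ?thesis by (rule eventually_happens'[OF sequentially_bot])
  qed
  then obtain N where N: "\<And>j. prob (B j (N j)) < (1/2) ^ j" by metis
  \<comment> \<open>Partial sums make the times strictly increasing and keep them above \<open>N j\<close>.\<close>
  define r where "r j = (\<Sum>i\<le>j. Suc (N i))" for j
  have "strict_mono r" by (rule strict_monoI_Suc) (simp add: r_def)
  have "N j \<le> r j" for j
  proof -
    have "Suc (N j) \<le> r j" unfolding r_def by (rule member_le_sum) auto
    then show ?thesis by simp
  qed
  then have "prob (B j (r j)) \<le> (1/2) ^ j" for j
    using finite_measure_mono[OF B_anti B, of "N j" "r j" j] N[of j] by (meson less_imp_le order_trans)
  then have "summable (\<lambda>j. prob (B j (r j)))"
    by (intro summable_comparison_test'[OF summable_geometric[of "1/2"]]) auto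
  then have "AE \<omega> in M. \<forall>\<^sub>F j in sequentially. \<omega> \<in> space M - B j (r j)"
    using B by (intro borel_cantelli_AE1) (auto simp: less_top[symmetric])
  then have "AE \<omega> in M. \<forall>\<^sub>F j in sequentially. k (r j) \<omega> \<ge> j"
    by eventually_elim (auto simp: B_def not_less elim: eventually_mono)
  with \<open>strict_mono r\<close> show ?thesis by (rule that)
qed

section \<open>Weights that grow more slowly than the visits\<close>

definition sparse_weights :: "(nat \<Rightarrow> nat) \<Rightarrow> nat \<Rightarrow> 'k::real_normed_field" where
  "sparse_weights r n = (if n \<in> range r then 2 else 1)"

lemma weight_prod_sparse: "weight_prod (sparse_weights r) n = 2 ^ card ({1..n} \<inter> range r)"
  by (simp add: weight_prod_def sparse_weights_def prod.If_cases)

lemma admissible_sparse_weights: "admissible_weights (\<lambda>n. c * sparse_weights r n)" if "c \<noteq> 0"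
  unfolding admissible_weights_def
proof
  have "range (\<lambda>n. c * sparse_weights r n) \<subseteq> {2 * c, c}" by (auto simp: sparse_weights_def)
  then show "bounded ((\<lambda>n. c * sparse_weights r n) ` {1..})"
    by (meson bounded_subset finite.intros finite_imp_bounded image_mono subset_UNIV order_trans)
qed (use that in \<open>auto simp: sparse_weights_def\<close>)

lemma sparse_weights_at_infinity:
  assumes r: "strict_mono r"
  shows "filterlim (weight_prod (sparse_weights r) :: nat \<Rightarrow> 'k::real_normed_field) at_infinity sequentially"
proof -
  have "filterlim (\<lambda>n. card ({1..n} \<inter> range r)) at_top sequentially"
    unfolding filterlim_at_top
  proof
    fix m
    have "m \<le> card ({1..n} \<inter> range r)" if "n \<ge> r m" for n
    proof -
      have "r ` {1..m} \<subseteq> {1..n} \<inter> range r"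
      proof -
        have "1 \<le> r i \<and> r i \<le> n" if "1 \<le> i" "i \<le> m" for i
          using strict_mono_imp_increasing[OF r, of i] strict_mono_less_eq[OF r, of i m] that \<open>n \<ge> r m\<close>
          by linarith
        then show ?thesis by auto
      qed
      then have "card (r ` {1..m}) \<le> card ({1..n} \<inter> range r)" by (intro card_mono) auto
      moreover have "inj_on r {1..m}" using r strict_mono_imp_inj_on inj_on_subset by blast
      ultimately show ?thesis by (simp add: card_image)
    qed
    then show "\<forall>\<^sub>F n in sequentially. m \<le> card ({1..n} \<inter> range r)"
      by (auto simp: eventually_sequentially)
  qed
  moreover have "filterlim (\<lambda>m. 2 ^ m :: real) at_top sequentially"
    using filterlim_realpow_sequentially_gt1[of "2 :: real"]
    by (simp add: filterlim_at_infinity_conv_norm_at_top norm_power)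
  ultimately have "filterlim (\<lambda>n. 2 ^ card ({1..n} \<inter> range r) :: real) at_top sequentially"
    by (rule filterlim_compose[rotated])
  then show ?thesis
    unfolding filterlim_at_infinity_conv_norm_at_top weight_prod_sparse by (simp add: norm_power)
qed

text \<open>
  If \<open>m + 1\<close> elements of the range of \<open>r\<close> lie in \<open>{1..n}\<close>, then \<open>r j \<le> n\<close> for some \<open>j \<ge> m\<close>, and
  monotonicity gives \<open>k n \<ge> k (r j) \<ge> j \<ge> m\<close> unless \<open>m < J\<close>.
\<close>

lemma sparse_count_le:
  assumes k: "\<And>m n. m \<le> n \<Longrightarrow> k m \<le> k n" and J: "\<And>j. j \<ge> J \<Longrightarrow> k (r j) \<ge> j"
  shows "card ({1..n} \<inter> range r) \<le> k n + J + 1"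
proof (cases "card ({1..n} \<inter> range r) \<le> J")
  case False
  define m where "m = card ({1..n} \<inter> range r) - 1"
  have m: "card ({1..n} \<inter> range r) = Suc m" "J \<le> m" using False by (auto simp: m_def)
  have "\<not> {1..n} \<inter> range r \<subseteq> r ` {..<m}"
  proof
    assume "{1..n} \<inter> range r \<subseteq> r ` {..<m}"
    then have "card ({1..n} \<inter> range r) \<le> card {..<m}" by (intro surj_card_le) auto
    then show False using m by simp
  qed
  then obtain j where "r j \<le> n" "r j \<notin> r ` {..<m}"
    unfolding subset_iff by fastforce
  then have "j \<ge> m" by (auto simp: not_less[symmetric])
  then have "m \<le> k n" using J[of j] k[of "r j" n] m(2) \<open>r j \<le> n\<close> by linarith
  then show ?thesis using m(1) by simp
qed simp

text \<open>
  The weight product of \<open>w\<close> is \<open>2\<close> to the number of the times \<open>r(j)\<close> between \<open>1\<close> and \<open>n\<close>. This number tends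
  to infinity, which makes \<open>B\<^sub>w\<close> mixing; it is at most \<open>n\<close>, so that \<open>2\<^bsup>-n\<^esup> W\<^sub>n\<close> is bounded and \<open>B\<^sub>v\<close> is not
  hypercyclic; and almost surely it exceeds the number of visits to the complement of \<open>A\<close> by at most a
  constant, so that the random product is not universal.
\<close>

theorem ergodic_counterexample:
  fixes X :: "(nat \<Rightarrow> 'k::{real_normed_field, euclidean_space}) metric"
  assumes X: "X = c0_space \<or> (\<exists>p\<ge>1. X = lp_space p)"
    and erg: "ergodic_system M \<tau>" and A: "A \<in> sets M" "measure M (space M - A) > 0"
  obtains w v :: "nat \<Rightarrow> 'k" where "admissible_weights w" "admissible_weights v"
    "commute_on X (weighted_shift w) (weighted_shift v)" "norm (w 1) > norm (v 1)"
    "mixing X (weighted_shift w)" "\<not> hypercyclic X (weighted_shift v)"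
    "AE \<omega> in M. \<not> universal X (random_shift_seq \<tau> A w v \<omega>)"
proof -
  have \<tau>: "\<tau> \<in> measurable M M" and "prob_space M"
    using erg by (auto simp: ergodic_system_def measure_preserving_system_def)
  interpret prob_space M by fact
  have A': "space M - A \<in> sets M" using A(1) by blast
  have unb: "AE \<omega> in M. \<forall>j. \<exists>n. visits \<tau> (space M - A) n \<omega> \<ge> j"
    using ergodic_visits_infinitely_often[OF erg A' A(2)]
    by eventually_elim (intro allI visits_unbounded)
  obtain r where r: "strict_mono r"
      and ev: "AE \<omega> in M. \<forall>\<^sub>F j in sequentially. visits \<tau> (space M - A) (r j) \<omega> \<ge> j"
    using sparse_lower_bound[where k = "visits \<tau> (space M - A)",
        OF visits_measurable[OF \<tau> A'] visits_mono unb] .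
  define w :: "nat \<Rightarrow> 'k" where "w = sparse_weights r"
  \<comment> \<open>Halving at each visit compensates the doubling of the weight product at each time \<open>r j\<close>.\<close>
  define v :: "nat \<Rightarrow> 'k" where "v n = 1 / 2 * w n" for n
  have w: "admissible_weights w" using admissible_sparse_weights[of 1 r] by (simp add: w_def)
  have v: "admissible_weights v" using admissible_sparse_weights[of "1 / 2" r] by (simp add: w_def v_def[abs_def])
  have Ww: "norm (weight_prod w n) = 2 ^ card ({1..n} \<inter> range r)" for n
    by (simp add: w_def weight_prod_sparse norm_power)
  show thesis
  proof (rule that[OF w v])
    show "commute_on X (weighted_shift w) (weighted_shift v)"
      by (simp add: commute_on_def weighted_shift_def v_def mult_ac)
    show "norm (v 1) < norm (w 1)" using w by (simp add: v_def norm_mult norm_divide admissible_weights_def)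
    show "mixing X (weighted_shift w)"
      unfolding mixing_weighted_shift_iff[OF X w] unfolding w_def using r by (rule sparse_weights_at_infinity)
    have "norm (weight_prod v n) \<le> 1" for n
    proof -
      have "card ({1..n} \<inter> range r) \<le> card {1..n}" by (intro card_mono) auto
      then have "(2::real) ^ card ({1..n} \<inter> range r) \<le> 2 ^ n" by simp
      then show ?thesis
        by (simp add: weight_prod_scaled[where v = v and w = w, OF v_def] norm_mult norm_power norm_divide Ww power_divide field_simps)
    qed
    then show "\<not> hypercyclic X (weighted_shift v)"
      unfolding hypercyclic_weighted_shift_iff[OF X v] by (auto intro: BseqI')
    show "AE \<omega> in M. \<not> universal X (random_shift_seq \<tau> A w v \<omega>)"
      using ev AE_space
    proof eventually_elim
      case (elim \<omega>)
      define k where "k n = visits \<tau> (- A) n \<omega>" for n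
      have "(\<tau> ^^ j) \<omega> \<in> space M" for j
        using measurable_space[OF iterate_measurable[OF \<tau>]] elim(2) .
      then have k_eq: "k n = visits \<tau> (space M - A) n \<omega>" for n
        by (simp add: k_def visits_def)
      obtain J where J: "\<And>j. j \<ge> J \<Longrightarrow> k (r j) \<ge> j"
        using elim(1) by (auto simp: k_eq eventually_sequentially)
      have kmono: "m \<le> n \<Longrightarrow> k m \<le> k n" for m n unfolding k_def by (rule visits_mono)
      have "norm ((1 / 2) ^ k n * weight_prod w n) \<le> 2 ^ (J + 1)" for n
      proof -
        have "(2::real) ^ card ({1..n} \<inter> range r) \<le> 2 ^ (k n + J + 1)"
          using sparse_count_le[of k J r n, OF kmono J] by (intro power_increasing) auto
        also have "\<dots> = 2 ^ k n * 2 ^ (J + 1)" by (simp add: power_add)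
        finally show ?thesis
          by (simp add: norm_mult norm_power norm_divide Ww power_divide divide_le_eq mult.commute)
      qed
      then have "Bseq (\<lambda>n. (1 / 2) ^ k n * weight_prod w n)" by (rule BseqI')
      moreover have "random_shift_seq \<tau> A w v \<omega> = scaled_shift_powers (\<lambda>n. (1 / 2) ^ k n) w"
        unfolding k_def by (rule random_shift_seq_eq) (rule v_def)
      moreover have "norm ((1 / 2 :: 'k) ^ k (Suc n)) \<le> norm ((1 / 2 :: 'k) ^ k n)" for n
        using kmono[of n "Suc n"] by (simp add: norm_power norm_divide power_decreasing)
      ultimately show ?case
        using universal_scaled_shift_powers_iff[OF X w, of "\<lambda>n. (1 / 2) ^ k n"] by simp
    qed
  qed
qed

theorem proposition1p3:
  fixes X :: "(nat \<Rightarrow> 'k::{real_normed_field, euclidean_space}) metric"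
    and M :: "'o measure" and \<tau> :: "'o \<Rightarrow> 'o" and A1 A2 :: "'o set"
  assumes X: "X = c0_space \<or> (\<exists>p\<ge>1. X = lp_space p)"
    and system: "measure_preserving_system M \<tau>"
    and partition: "A1 \<in> sets M" "A2 \<in> sets M" "A1 \<union> A2 = space M" "A1 \<inter> A2 = {}"
    and positive: "measure M A1 > 0" "measure M A2 > 0"
  shows
    "(\<forall>w v :: nat \<Rightarrow> 'k.
        admissible_weights w \<and> admissible_weights v \<and>
        commute_on X (weighted_shift w) (weighted_shift v) \<and> norm (w 1) > norm (v 1) \<longrightarrow>
        (hypercyclic X (weighted_shift v) \<longrightarrow>
           (\<forall>\<omega>\<in>space M. universal X (random_shift_seq \<tau> A1 w v \<omega>))) \<and>
        ((\<exists>\<omega>\<in>space M. universal X (random_shift_seq \<tau> A1 w v \<omega>)) \<longrightarrow>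
           hypercyclic X (weighted_shift w)) \<and>
        (mixing X (weighted_shift v) \<longrightarrow>
           (\<forall>\<omega>\<in>space M. mixing_seq X (random_shift_seq \<tau> A1 w v \<omega>))) \<and>
        ((\<exists>\<omega>\<in>space M. mixing_seq X (random_shift_seq \<tau> A1 w v \<omega>)) \<longrightarrow>
           mixing X (weighted_shift w)))
     \<and>
     (ergodic_system M \<tau> \<longrightarrow>
        (\<exists>w v :: nat \<Rightarrow> 'k.
           admissible_weights w \<and> admissible_weights v \<and>
           commute_on X (weighted_shift w) (weighted_shift v) \<and> norm (w 1) > norm (v 1) \<and>
           mixing X (weighted_shift w) \<and>
           \<not> hypercyclic X (weighted_shift v) \<and>
           (AE \<omega> in M. \<not> universal X (random_shift_seq \<tau> A1 w v \<omega>))))"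
proof (intro conjI allI impI ballI)
  fix w v :: "nat \<Rightarrow> 'k"
  assume "admissible_weights w \<and> admissible_weights v \<and>
    commute_on X (weighted_shift w) (weighted_shift v) \<and> norm (w 1) > norm (v 1)"
  then have wv: "admissible_weights w" "admissible_weights v"
    "commute_on X (weighted_shift w) (weighted_shift v)" "norm (w 1) > norm (v 1)" by auto
  note between = random_shift_between[OF X wv]
  show "universal X (random_shift_seq \<tau> A1 w v \<omega>)" if "hypercyclic X (weighted_shift v)" for \<omega>
    using that by (rule between(1))
  show "hypercyclic X (weighted_shift w)"
    if "\<exists>\<omega>\<in>space M. universal X (random_shift_seq \<tau> A1 w v \<omega>)"
    using that by (elim bexE) (rule between(2))
  show "mixing_seq X (random_shift_seq \<tau> A1 w v \<omega>)" if "mixing X (weighted_shift v)" for \<omega>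
    using that by (rule between(3))
  show "mixing X (weighted_shift w)"
    if "\<exists>\<omega>\<in>space M. mixing_seq X (random_shift_seq \<tau> A1 w v \<omega>)"
    using that by (elim bexE) (rule between(4))
next
  assume erg: "ergodic_system M \<tau>"
  have "space M - A1 = A2" using partition by blast
  then have "measure M (space M - A1) > 0" using positive(2) by simp
  from ergodic_counterexample[OF X erg partition(1) this]
  obtain w v :: "nat \<Rightarrow> 'k" where "admissible_weights w" "admissible_weights v"
    "commute_on X (weighted_shift w) (weighted_shift v)" "norm (w 1) > norm (v 1)"
    "mixing X (weighted_shift w)" "\<not> hypercyclic X (weighted_shift v)"
    "AE \<omega> in M. \<not> universal X (random_shift_seq \<tau> A1 w v \<omega>)" .
  then show "\<exists>w v :: nat \<Rightarrow> 'k.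
           admissible_weights w \<and> admissible_weights v \<and>
           commute_on X (weighted_shift w) (weighted_shift v) \<and> norm (w 1) > norm (v 1) \<and>
           mixing X (weighted_shift w) \<and>
           \<not> hypercyclic X (weighted_shift v) \<and>
           (AE \<omega> in M. \<not> universal X (random_shift_seq \<tau> A1 w v \<omega>))"
    by (intro exI conjI)
qed

end
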